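(* Suppose that $(A_{\text{true}},B_{\text{true}})\in\Sigma_{\text{stab}}$ and $\operatorname{rank}X_-<n$. Then the data $\mathcal{D}$ are $\Sigma_{\text{stab}}$-informative for stabilization if and only if the following two conditions hold: (a) $\operatorname{im}X_+\subseteq\operatorname{im}X_-$, (b) $\operatorname{im}\begin{bmatrix} X_- \\ U_- \end{bmatrix}=\operatorname{im}X_-\times\mathbb{R}^m$.
   Context: Let $n,m,T$ be positive integers and $\mathcal{M}=\mathbb{R}^{n\times n}\times\mathbb{R}^{n\times m}$. Let $(A_{\text{true}},B_{\text{true}})\in\mathcal{M}$ be the (unknown) true system. The data $\mathcal{D}$ consist of inputs $u(0),\dots,u(T-1)\in\mathbb{R}^m$ and states $x(0),\dots,x(T)\in\mathbb{R}^n$ satisfying $x(t+1)=A_{\text{true}}x(t)+B_{\text{true}}u(t)$ for $t=0,\dots,T-1$. Set $U_-=\begin{bmatrix}u(0)&\cdots&u(T-1)\end{bmatrix}$, $X_-=\begin{bmatrix}x(0)&\cdots&x(T-1)\end{bmatrix}$, $X_+=\begin{bmatrix}x(1)&\cdots&x(T)\end{bmatrix}$. The set of data-consistent systems is $\Sigma_{\mathcal{D}}=\{(A,B)\in\mathcal{M}\mid X_+=AX_-+BU_-\}$. A real square matrix is Schur if all its eigenvalues have modulus strictly less than $1$. The set $\Sigma_{\text{stab}}$ is the set of all stabilizable pairs $(A,B)\in\mathcal{M}$, i.e. those for which there is $K\in\mathbb{R}^{m\times n}$ with $A+BK$ Schur. The data $\mathcal{D}$ are called $\Sigma_{\text{stab}}$-informative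 for stabilization if there exists a single $K\in\mathbb{R}^{m\times n}$ such that $A+BK$ is Schur for all $(A,B)\in\Sigma_{\mathcal{D}}\cap\Sigma_{\text{stab}}$. The product $\operatorname{im}X_-\times\mathbb{R}^m$ is identified with a subspace of $\mathbb{R}^{n+m}$ by stacking vectors. *)

theory Defs
  imports
    "Jordan_Normal_Form.Char_Poly"
    "Jordan_Normal_Form.DL_Rank"
begin

definition schur :: "real mat \<Rightarrow> bool" where
  "schur M \<longleftrightarrow> square_mat M \<and>
    (\<forall>z. eigenvalue (map_mat complex_of_real M) z \<longrightarrow> cmod z < 1)"

definition stabilizable :: "nat \<Rightarrow> nat \<Rightarrow> real mat \<Rightarrow> real mat \<Rightarrow> bool" where
  "stabilizable n m A B \<longleftrightarrow> (\<exists>K \<in> carrier_mat m n. schur (A + B * K))"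

definition systems :: "nat \<Rightarrow> nat \<Rightarrow> (real mat \<times> real mat) set" where
  "systems n m = carrier_mat n n \<times> carrier_mat n m"

definition Sigma_stab :: "nat \<Rightarrow> nat \<Rightarrow> (real mat \<times> real mat) set" where
  "Sigma_stab n m = {(A, B) \<in> systems n m. stabilizable n m A B}"

text \<open>The data are input and state trajectories \<open>u, x :: nat \<Rightarrow> real vec\<close> of which only
  \<open>u 0, \<dots>, u (T - 1)\<close> and \<open>x 0, \<dots>, x T\<close> are used.\<close>

definition U_minus :: "nat \<Rightarrow> nat \<Rightarrow> (nat \<Rightarrow> real vec) \<Rightarrow> real mat" where
  "U_minus m T u = mat_of_cols m (map u [0..<T])"

definition X_minus :: "nat \<Rightarrow> nat \<Rightarrow> (nat \<Rightarrow> real vec) \<Rightarrow> real mat" where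
  "X_minus n T x = mat_of_cols n (map x [0..<T])"

definition X_plus :: "nat \<Rightarrow> nat \<Rightarrow> (nat \<Rightarrow> real vec) \<Rightarrow> real mat" where
  "X_plus n T x = mat_of_cols n (map x [1..<T + 1])"

definition Sigma_data ::
  "nat \<Rightarrow> nat \<Rightarrow> nat \<Rightarrow> (nat \<Rightarrow> real vec) \<Rightarrow> (nat \<Rightarrow> real vec) \<Rightarrow> (real mat \<times> real mat) set" where
  "Sigma_data n m T u x =
    {(A, B) \<in> systems n m. X_plus n T x = A * X_minus n T x + B * U_minus m T u}"

definition informative_for_stabilization ::
  "(real mat \<times> real mat) set \<Rightarrow> nat \<Rightarrow> nat \<Rightarrow> nat \<Rightarrow> (nat \<Rightarrow> real vec) \<Rightarrow> (nat \<Rightarrow> real vec) \<Rightarrow> bool" where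
  "informative_for_stabilization S n m T u x \<longleftrightarrow>
    (\<exists>K \<in> carrier_mat m n. \<forall>(A, B) \<in> Sigma_data n m T u x \<inter> S. schur (A + B * K))"

definition mat_image :: "real mat \<Rightarrow> real vec set" where
  "mat_image M = (\<lambda>v. M *\<^sub>v v) ` carrier_vec (dim_col M)"

definition stacked_product :: "real vec set \<Rightarrow> real vec set \<Rightarrow> real vec set" where
  "stacked_product V W = {v @\<^sub>v w | v w. v \<in> V \<and> w \<in> W}"

end

theory Submission
  imports Defs "Jordan_Normal_Form.Schur_Decomposition" "HOL-Analysis.Elementary_Topology"
begin

text \<open>
  Write \<open>V = im X\<^sub>-\<close>. If (a) and (b) hold, all consistent systems share \<open>B\<close> and the restriction of
  \<open>A\<close> to \<open>V\<close>, and \<open>V\<close> is invariant and contains \<open>im B\<close>. A gain stabilizing the true system then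
  works for every consistent stabilizable \<open>(A, B)\<close>: on \<open>V\<close> the closed loop is the true one, and on
  the quotient it does not depend on the gain.

  Conversely, if (b) or (a) fails, we perturb the true system by rank-one matrices that annihilate
  the data, keeping it stabilizable while the trace of the closed loop with any fixed gain becomes
  arbitrarily large; but the trace of a Schur matrix of size \<open>n\<close> is at most \<open>n\<close> in modulus.
  If (b) fails, stabilizability survives because Schur matrices form an open set. If (b) holds and
  (a) fails, then \<open>V\<close> does not contain the reachable subspace of \<open>(A, B)\<close>: otherwise the largest
  index in a linear relation among \<open>x(0), \<dots>, x(T-1)\<close>, which exists by (b), could be shifted to
  \<open>T\<close>, giving \<open>x(T) \<in> V\<close>. A functional \<open>\<eta>\<close> on the quotient by \<open>V\<close> with \<open>\<eta> A\<^sup>l B \<noteq> 0\<close>, \<open>l\<close> minimal,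
  yields perturbed systems similar, up to feedback, to the true one.
\<close>

section \<open>Rank-one matrices and the trace\<close>

definition outer :: "'a::comm_ring_1 vec \<Rightarrow> 'a vec \<Rightarrow> 'a mat" where
  "outer a f = mat (dim_vec a) (dim_vec f) (\<lambda>(i, j). a $ i * f $ j)"

lemma outer_carrier [simp, intro]:
  "a \<in> carrier_vec n \<Longrightarrow> f \<in> carrier_vec k \<Longrightarrow> outer a f \<in> carrier_mat n k"
  by (auto simp: outer_def)

lemma dim_outer [simp]: "dim_row (outer a f) = dim_vec a" "dim_col (outer a f) = dim_vec f"
  by (auto simp: outer_def)

lemma index_outer [simp]: "i < dim_vec a \<Longrightarrow> j < dim_vec f \<Longrightarrow> outer a f $$ (i, j) = a $ i * f $ j"
  by (auto simp: outer_def)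

lemma outer_mult_vec:
  assumes "f \<in> carrier_vec k" "v \<in> carrier_vec k"
  shows "outer a f *\<^sub>v v = (f \<bullet> v) \<cdot>\<^sub>v a"
  using assms by (intro eq_vecI) (auto simp: scalar_prod_def sum_distrib_left ac_simps)

lemma mult_outer:
  assumes "B \<in> carrier_mat n m" "e \<in> carrier_vec m"
  shows "B * outer e h = outer (B *\<^sub>v e) h"
  using assms by (intro eq_matI) (auto simp: scalar_prod_def sum_distrib_left sum_distrib_right ac_simps)

lemma outer_mult:
  assumes "q \<in> carrier_vec m" "K \<in> carrier_mat m k"
  shows "outer a q * K = outer a (K\<^sup>T *\<^sub>v q)"
  using assms by (intro eq_matI) (auto simp: scalar_prod_def sum_distrib_left sum_distrib_right ac_simps)

definition mat_trace :: "'a::comm_ring_1 mat \<Rightarrow> 'a" where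
  "mat_trace A = (\<Sum>i<dim_row A. A $$ (i, i))"

lemma mat_trace_add:
  assumes "A \<in> carrier_mat n n" "B \<in> carrier_mat n n"
  shows "mat_trace (A + B) = mat_trace A + mat_trace B"
  using assms by (auto simp: mat_trace_def sum.distrib)

lemma mat_trace_outer:
  assumes "a \<in> carrier_vec n" "f \<in> carrier_vec n"
  shows "mat_trace (outer a f) = f \<bullet> a"
  using assms by (auto simp: mat_trace_def scalar_prod_def lessThan_atLeast0 ac_simps intro!: sum.cong)

lemma mat_trace_comm:
  assumes "A \<in> carrier_mat n m" "B \<in> carrier_mat m n"
  shows "mat_trace (A * B) = mat_trace (B * A)"
proof -
  have "mat_trace (A * B) = (\<Sum>i<n. \<Sum>j<m. A $$ (i, j) * B $$ (j, i))"
    using assms by (auto simp: mat_trace_def scalar_prod_def lessThan_atLeast0 intro!: sum.cong)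
  also have "\<dots> = (\<Sum>j<m. \<Sum>i<n. A $$ (i, j) * B $$ (j, i))"
    by (rule sum.swap)
  also have "\<dots> = mat_trace (B * A)"
    using assms by (auto simp: mat_trace_def scalar_prod_def lessThan_atLeast0 ac_simps intro!: sum.cong)
  finally show ?thesis .
qed

lemma smult_mat_mult_vec:
  assumes "dim_col A = dim_vec v"
  shows "(c \<cdot>\<^sub>m A) *\<^sub>v v = c \<cdot>\<^sub>v (A *\<^sub>v v)"
  using assms by (intro eq_vecI) (auto simp: scalar_prod_def sum_distrib_left ac_simps)

lemma minus_vec_eq_zero_iff:
  fixes v w :: "'a::ab_group_add vec"
  assumes "v \<in> carrier_vec n" "w \<in> carrier_vec n"
  shows "v - w = 0\<^sub>v n \<longleftrightarrow> v = w"
  using assms by (auto simp: vec_eq_iff)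

section \<open>Schur matrices\<close>

lemma schurD:
  assumes "schur M" "M \<in> carrier_mat n n" "v \<in> carrier_vec n" "v \<noteq> 0\<^sub>v n"
    "map_mat complex_of_real M *\<^sub>v v = z \<cdot>\<^sub>v v"
  shows "cmod z < 1"
  using assms unfolding schur_def eigenvalue_def eigenvector_def by auto

lemma schurI:
  assumes "M \<in> carrier_mat n n"
    "\<And>z v. v \<in> carrier_vec n \<Longrightarrow> v \<noteq> 0\<^sub>v n \<Longrightarrow>
      map_mat complex_of_real M *\<^sub>v v = z \<cdot>\<^sub>v v \<Longrightarrow> cmod z < 1"
  shows "schur M"
  using assms unfolding schur_def eigenvalue_def eigenvector_def by auto

text \<open>Over the complex numbers the matrix is similar to an upper triangular one. The diagonal
  entries there are eigenvalues, hence of modulus below 1, and similarity preserves the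
  trace.\<close>

lemma schur_trace_bound:
  assumes "schur M" "M \<in> carrier_mat n n"
  shows "\<bar>mat_trace M\<bar> \<le> n"
proof -
  let ?M = "map_mat complex_of_real M"
  have M: "?M \<in> carrier_mat n n" using assms by auto
  obtain es where es: "char_poly ?M = (\<Prod>a\<leftarrow>es. [:- a, 1:])"
    using char_poly_factorized[OF M] by blast
  from schur_decomposition_exists[OF M es] obtain B where
    B: "B \<in> carrier_mat n n" and ut: "upper_triangular B" and sim: "similar_mat ?M B" by blast
  from sim obtain P Q where "similar_mat_wit ?M B P Q" unfolding similar_mat_def by blast
  from similar_mat_witD2[OF M this] have
    PQ: "P \<in> carrier_mat n n" "Q \<in> carrier_mat n n" "Q * P = 1\<^sub>m n" "?M = P * B * Q" by auto
  have diag: "cmod (B $$ (i, i)) < 1" if "i < n" for i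
  proof -
    have "poly (char_poly B) (B $$ (i, i)) = 0"
      unfolding char_poly_upper_triangular[OF B ut] poly_prod_list prod_list_zero_iff
      using that B by (auto simp: diag_mat_def intro!: image_eqI[of _ _ i] bexI)
    hence "eigenvalue ?M (B $$ (i, i))"
      unfolding eigenvalue_root_char_poly[OF M] char_poly_similar[OF sim] .
    thus ?thesis using assms unfolding schur_def by blast
  qed
  have "complex_of_real (mat_trace M) = mat_trace ?M"
    using assms by (auto simp: mat_trace_def)
  also have "\<dots> = mat_trace (P * (B * Q))"
    using PQ(1,2,4) B by (simp add: assoc_mult_mat[of _ n n _ n _ n])
  also have "\<dots> = mat_trace (B * Q * P)"
    by (rule mat_trace_comm[of _ n n]) (use PQ B in auto)
  also have "B * Q * P = B"
    using PQ B by (simp add: assoc_mult_mat[of _ n n _ n _ n])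
  finally have "\<bar>mat_trace M\<bar> = cmod (mat_trace B)"
    by (metis norm_of_real real_norm_def)
  also have "\<dots> \<le> (\<Sum>i<n. cmod (B $$ (i, i)))"
    unfolding mat_trace_def using B by (auto intro: norm_sum)
  also have "\<dots> \<le> (\<Sum>i<n. 1)"
    by (rule sum_mono) (use diag in \<open>auto intro: less_imp_le\<close>)
  finally show ?thesis by simp
qed

text \<open>This is the obstruction that defeats a fixed gain \<open>K\<close>: the right-hand side
  does not depend on the perturbation, so a consistent stabilizable perturbation with large
  \<open>\<eta> \<bullet> d\<close> cannot be stabilized by \<open>K\<close>.\<close>

lemma schur_rank_one_update_bound:
  fixes A B K :: "real mat"
  assumes "A \<in> carrier_mat n n" "B \<in> carrier_mat n m" "K \<in> carrier_mat m n"
    and "d \<in> carrier_vec n" "\<eta> \<in> carrier_vec n"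
    and "schur ((A + outer d \<eta>) + B * K)"
  shows "\<eta> \<bullet> d \<le> real n - mat_trace (A + B * K)"
proof -
  have "(A + outer d \<eta>) + B * K = (A + B * K) + outer d \<eta>"
    using assms by (intro eq_matI) (auto simp del: index_mult_mat(1))
  hence "mat_trace ((A + outer d \<eta>) + B * K) = mat_trace (A + B * K) + \<eta> \<bullet> d"
    using assms by (simp add: mat_trace_add[of _ n] mat_trace_outer[of _ n])
  moreover have "\<bar>mat_trace ((A + outer d \<eta>) + B * K)\<bar> \<le> n"
    by (rule schur_trace_bound[OF assms(6)]) (use assms in auto)
  ultimately show ?thesis by linarith
qed

text \<open>An eigenvector \<open>v\<close> of \<open>N\<close> is carried by the invertible
  \<open>S\<close> to an eigenvector of \<open>M\<close> for the same eigenvalue. Stating similarity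
  as an intertwining relation spares the inverse of \<open>S\<close>.\<close>

lemma schur_intertwined:
  assumes M: "M \<in> carrier_mat n n" and N: "N \<in> carrier_mat n n" and S: "S \<in> carrier_mat n n"
    and "det S \<noteq> 0" "S * N = M * S" "schur M"
  shows "schur N"
proof (rule schurI[OF N])
  fix z :: complex and v :: "complex vec"
  let ?h = "map_mat complex_of_real"
  assume v: "v \<in> carrier_vec n" "v \<noteq> 0\<^sub>v n" "?h N *\<^sub>v v = z \<cdot>\<^sub>v v"
  have c: "?h M \<in> carrier_mat n n" "?h N \<in> carrier_mat n n" "?h S \<in> carrier_mat n n"
    using M N S by auto
  have "?h S * ?h N = ?h M * ?h S"
    using assms(5) M N S by (metis of_real_hom.mat_hom_mult)
  hence "?h M *\<^sub>v (?h S *\<^sub>v v) = ?h S *\<^sub>v (?h N *\<^sub>v v)"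
    using c v(1) by (metis assoc_mult_mat_vec)
  also have "\<dots> = z \<cdot>\<^sub>v (?h S *\<^sub>v v)"
    using v c by (simp add: mult_mat_vec)
  finally have ev: "?h M *\<^sub>v (?h S *\<^sub>v v) = z \<cdot>\<^sub>v (?h S *\<^sub>v v)" .
  have "det (?h S) \<noteq> 0" using assms(4) by simp
  hence "?h S *\<^sub>v v \<noteq> 0\<^sub>v n" using v c det_0_iff_vec_prod_zero[OF c(3)] by blast
  thus "cmod z < 1" using schurD[OF assms(6) M _ _ ev] c v by auto
qed

text \<open>An eigenvalue of modulus at least 1 appears as a zero of a determinant that is jointly
  continuous in the perturbation size and a parameter from the closed unit disc. For
  \<open>\<epsilon> = 0\<close> there is no zero on the disc, and the tube lemma extends this to all
  small \<open>\<epsilon>\<close>.\<close>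

lemma schur_open:
  assumes M: "M \<in> carrier_mat n n" and R: "R \<in> carrier_mat n n" and s: "schur M"
  shows "\<exists>\<delta>>0. \<forall>\<epsilon>. \<bar>\<epsilon>\<bar> < \<delta> \<longrightarrow> schur (M + \<epsilon> \<cdot>\<^sub>m R)"
proof -
  let ?h = "map_mat complex_of_real"
  \<comment> \<open>Substituting \<open>\<zeta> = 1 / z\<close> turns the exterior of the unit disc into a compact set of parameters.\<close>
  define F where "F = (\<lambda>(\<epsilon>::real, \<zeta>::complex). 1\<^sub>m n - \<zeta> \<cdot>\<^sub>m ?h (M + \<epsilon> \<cdot>\<^sub>m R))"
  have F: "F p \<in> carrier_mat n n" for p using M R by (auto simp: F_def split: prod.split)
  have key: "det (F (\<epsilon>, \<zeta>)) = 0 \<longleftrightarrow>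
      (\<exists>v. v \<in> carrier_vec n \<and> v \<noteq> 0\<^sub>v n \<and> v = \<zeta> \<cdot>\<^sub>v (?h (M + \<epsilon> \<cdot>\<^sub>m R) *\<^sub>v v))" for \<epsilon> \<zeta>
  proof -
    have "F (\<epsilon>, \<zeta>) *\<^sub>v v = 0\<^sub>v n \<longleftrightarrow> v = \<zeta> \<cdot>\<^sub>v (?h (M + \<epsilon> \<cdot>\<^sub>m R) *\<^sub>v v)"
      if v: "v \<in> carrier_vec n" for v
    proof -
      have c: "?h (M + \<epsilon> \<cdot>\<^sub>m R) \<in> carrier_mat n n" using M R by auto
      define w where "w = \<zeta> \<cdot>\<^sub>v (?h (M + \<epsilon> \<cdot>\<^sub>m R) *\<^sub>v v)"
      have w: "w \<in> carrier_vec n" unfolding w_def using c v by auto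
      have "F (\<epsilon>, \<zeta>) *\<^sub>v v = 1\<^sub>m n *\<^sub>v v - (\<zeta> \<cdot>\<^sub>m ?h (M + \<epsilon> \<cdot>\<^sub>m R)) *\<^sub>v v"
        unfolding F_def split by (rule minus_mult_distrib_mat_vec) (use c that in auto)
      hence "F (\<epsilon>, \<zeta>) *\<^sub>v v = v - w"
        using smult_mat_mult_vec[of "?h (M + \<epsilon> \<cdot>\<^sub>m R)" v \<zeta>] carrier_matD[OF c] carrier_vecD[OF v]
          one_mult_mat_vec[OF v] unfolding w_def by metis
      moreover have "v - w = 0\<^sub>v n \<longleftrightarrow> v = w"
        using v w by (rule minus_vec_eq_zero_iff)
      ultimately show ?thesis unfolding w_def by simp
    qed
    thus ?thesis unfolding det_0_iff_vec_prod_zero[OF F] by blast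
  qed
  \<comment> \<open>By the Leibniz formula the determinant is a polynomial expression in the two
    parameters.\<close>
  have "continuous_on UNIV (\<lambda>p. det (F p))"
  proof -
    have "det (F p) = (\<Sum>\<pi> | \<pi> permutes {0..<n}. signof \<pi> *
        (\<Prod>i=0..<n. (if i = \<pi> i then 1 else 0) -
          snd p * (complex_of_real (M $$ (i, \<pi> i)) + complex_of_real (fst p) * complex_of_real (R $$ (i, \<pi> i)))))"
      for p
      unfolding det_def'[OF F]
    proof (intro sum.cong refl arg_cong2[of _ _ _ _ times] prod.cong)
      fix \<pi> i assume "\<pi> \<in> {\<pi>. \<pi> permutes {0..<n}}" "i \<in> {0..<n}"
      hence "i < n" "\<pi> i < n" by (auto dest: permutes_in_image)
      thus "F p $$ (i, \<pi> i) = (if i = \<pi> i then 1 else 0) -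
          snd p * (complex_of_real (M $$ (i, \<pi> i)) + complex_of_real (fst p) * complex_of_real (R $$ (i, \<pi> i)))"
        using M R by (auto simp: F_def split: prod.split)
    qed
    thus ?thesis by (simp only:) (intro continuous_intros)
  qed
  hence op: "open {p. det (F p) \<noteq> 0}"
    by (rule open_Collect_neq) (rule continuous_on_const)
  \<comment> \<open>Polar coordinates present the closed unit disc as the continuous image of a
    rectangle, which makes it compact.\<close>
  define D where "D = (\<lambda>p. rcis (fst p) (snd p)) ` ({0..1} \<times> {-pi..pi})"
  have D: "\<zeta> \<in> D \<longleftrightarrow> cmod \<zeta> \<le> 1" for \<zeta>
  proof
    assume "cmod \<zeta> \<le> 1"
    thus "\<zeta> \<in> D" unfolding D_def using rcis_cmod_Arg[of \<zeta>] Arg_bounded[of \<zeta>]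
      by (intro image_eqI[of _ _ "(cmod \<zeta>, Arg \<zeta>)"]) auto
  qed (auto simp: D_def)
  have "compact D"
    unfolding D_def rcis_def cis.ctr
    by (intro compact_continuous_image compact_Times compact_Icc continuous_intros)
  have "{0} \<times> D \<subseteq> {p. det (F p) \<noteq> 0}"
  proof safe
    fix \<zeta> :: complex assume \<zeta>: "\<zeta> \<in> D" and "det (F (0, \<zeta>)) = 0"
    then obtain v where v: "v \<in> carrier_vec n" "v \<noteq> 0\<^sub>v n" "v = \<zeta> \<cdot>\<^sub>v (?h (M + 0 \<cdot>\<^sub>m R) *\<^sub>v v)"
      using key by blast
    have "M + 0 \<cdot>\<^sub>m R = M" using M R by (auto intro!: eq_matI)
    hence v3: "v = \<zeta> \<cdot>\<^sub>v (?h M *\<^sub>v v)" using v(3) by simp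
    \<comment> \<open>The parameter 0 stands for no eigenvalue and is ruled out first; any other
      \<open>\<zeta>\<close> in the disc would make \<open>1 / \<zeta>\<close> an eigenvalue of
      \<open>M\<close> of modulus at least 1.\<close>
    have "\<zeta> \<noteq> 0"
    proof
      assume "\<zeta> = 0"
      moreover have "0 \<cdot>\<^sub>v (?h M *\<^sub>v v) = 0\<^sub>v n" using M by (intro eq_vecI) auto
      ultimately have "v = 0\<^sub>v n" using v3 by metis
      thus False using v(2) by simp
    qed
    hence "(1 / \<zeta>) \<cdot>\<^sub>v v = ?h M *\<^sub>v v" using arg_cong[OF v3, of "\<lambda>v. (1 / \<zeta>) \<cdot>\<^sub>v v"] by (simp add: smult_smult_assoc)
    from schurD[OF s M v(1,2) this[symmetric]] have "cmod (1 / \<zeta>) < 1" .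
    thus False using \<zeta> D \<open>\<zeta> \<noteq> 0\<close> by (auto simp: norm_divide field_simps)
  qed
  from tube_lemma[OF \<open>compact D\<close> op this] obtain X0 where
    X0: "0 \<in> X0" "open X0" "X0 \<times> D \<subseteq> {p. det (F p) \<noteq> 0}" by blast
  then obtain \<delta> where \<delta>: "\<delta> > 0" "\<And>\<epsilon>. \<bar>\<epsilon>\<bar> < \<delta> \<Longrightarrow> \<epsilon> \<in> X0"
    unfolding open_dist by (auto simp: dist_real_def)
  have "schur (M + \<epsilon> \<cdot>\<^sub>m R)" if "\<bar>\<epsilon>\<bar> < \<delta>" for \<epsilon>
  proof (rule schurI[of _ n])
    fix z v assume v: "v \<in> carrier_vec n" "v \<noteq> 0\<^sub>v n" "?h (M + \<epsilon> \<cdot>\<^sub>m R) *\<^sub>v v = z \<cdot>\<^sub>v v"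
    show "cmod z < 1"
    proof (rule ccontr)
      assume z: "\<not> cmod z < 1"
      hence "z \<noteq> 0" by auto
      hence "v = (1 / z) \<cdot>\<^sub>v (?h (M + \<epsilon> \<cdot>\<^sub>m R) *\<^sub>v v)" unfolding v(3) by (simp add: smult_smult_assoc)
      hence "det (F (\<epsilon>, 1 / z)) = 0" using key v by blast
      moreover have "1 / z \<in> D" using z D by (auto simp: norm_divide divide_le_eq_1)
      ultimately show False using X0(3) \<delta>(2)[OF that] by auto
    qed
  qed (use M R in auto)
  thus ?thesis using \<delta>(1) by blast
qed

section \<open>Images and orthogonal projections\<close>

lemma mat_eq_by_vec:
  fixes A B :: "'a::comm_ring_1 mat"
  assumes A: "A \<in> carrier_mat n k" and B: "B \<in> carrier_mat n k"
    and eq: "\<And>v. v \<in> carrier_vec k \<Longrightarrow> A *\<^sub>v v = B *\<^sub>v v"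
  shows "A = B"
proof (rule eq_matI)
  fix i j assume ij: "i < dim_row B" "j < dim_col B"
  have "(A *\<^sub>v unit_vec k j) $ i = (B *\<^sub>v unit_vec k j) $ i" using eq by simp
  thus "A $$ (i, j) = B $$ (i, j)" using ij A B by simp
qed (use A B in auto)

lemma mat_surj_if_inj:
  fixes S :: "'a::field mat"
  assumes S: "S \<in> carrier_mat n n" and "det S \<noteq> 0" and w: "w \<in> carrier_vec n"
  obtains d where "d \<in> carrier_vec n" "S *\<^sub>v d = w"
proof -
  from det_non_zero_imp_unit[OF assms(1,2), of "()"] obtain T where
    T: "T \<in> carrier_mat n n" "S * T = 1\<^sub>m n"
    unfolding Units_def ring_mat_def by auto
  show ?thesis
  proof (rule that[of "T *\<^sub>v w"])
    show "S *\<^sub>v (T *\<^sub>v w) = w"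
      using assoc_mult_mat_vec[OF S T(1) w] T(2) w by simp
  qed (use T w in auto)
qed

lemma scalar_prod_self_eq_0:
  fixes q :: "real vec"
  assumes "q \<in> carrier_vec n" "q \<bullet> q = 0"
  shows "q = 0\<^sub>v n"
proof -
  have "(\<Sum>i<n. q $ i * q $ i) = 0"
    using assms by (simp add: scalar_prod_def lessThan_atLeast0)
  hence "\<forall>i<n. q $ i * q $ i = 0"
    by (subst (asm) sum_nonneg_eq_0_iff) auto
  thus ?thesis using assms(1) by (intro eq_vecI) auto
qed

lemma mat_of_cols_map_scalar_prod:
  fixes \<phi> :: "'a::comm_ring_1 vec"
  assumes "\<And>t. t < T \<Longrightarrow> x t \<in> carrier_vec n" "\<phi> \<in> carrier_vec n" "c \<in> carrier_vec T"
  shows "\<phi> \<bullet> (mat_of_cols n (map x [0..<T]) *\<^sub>v c) = (\<Sum>t<T. c $ t * (\<phi> \<bullet> x t))"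
proof -
  have dim: "dim_vec (x t) = n" if "t < T" for t using assms(1)[OF that] by simp
  have "\<phi> \<bullet> (mat_of_cols n (map x [0..<T]) *\<^sub>v c) = (\<Sum>i<n. \<Sum>t<T. \<phi> $ i * (x t $ i * c $ t))"
    using assms by (simp add: scalar_prod_def lessThan_atLeast0 mat_of_cols_index sum_distrib_left)
  also have "\<dots> = (\<Sum>t<T. \<Sum>i<n. \<phi> $ i * (x t $ i * c $ t))" by (rule sum.swap)
  also have "\<dots> = (\<Sum>t<T. c $ t * (\<phi> \<bullet> x t))"
    by (intro sum.cong refl)
      (simp add: dim scalar_prod_def[of \<phi>] lessThan_atLeast0 sum_distrib_left ac_simps)
  finally show ?thesis .
qed

lemma mat_image_carrier: "X \<in> carrier_mat n k \<Longrightarrow> v \<in> mat_image X \<Longrightarrow> v \<in> carrier_vec n"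
  by (auto simp: mat_image_def)

lemma mat_image_snoc:
  assumes x: "x \<in> carrier_vec n"
  shows "mat_image (mat_of_cols n (xs @ [x])) =
    {y + a \<cdot>\<^sub>v x | y a. y \<in> mat_image (mat_of_cols n xs)}"
proof -
  let ?k = "length xs"
  have eq: "mat_of_cols n (xs @ [x]) *\<^sub>v c =
      mat_of_cols n xs *\<^sub>v vec ?k (($) c) + c $ ?k \<cdot>\<^sub>v x" if "c \<in> carrier_vec (Suc ?k)" for c
    using that x
    by (intro eq_vecI) (auto simp: scalar_prod_def mat_of_cols_index nth_append ac_simps intro!: sum.cong)
  show ?thesis
  proof (intro equalityI subsetI)
    fix v assume "v \<in> mat_image (mat_of_cols n (xs @ [x]))"
    then obtain c where "c \<in> carrier_vec (Suc ?k)" "v = mat_of_cols n (xs @ [x]) *\<^sub>v c"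
      by (auto simp: mat_image_def)
    thus "v \<in> {y + a \<cdot>\<^sub>v x | y a. y \<in> mat_image (mat_of_cols n xs)}"
      unfolding mat_image_def using eq by fastforce
  next
    fix v assume "v \<in> {y + a \<cdot>\<^sub>v x | y a. y \<in> mat_image (mat_of_cols n xs)}"
    then obtain c a where c: "c \<in> carrier_vec ?k" "v = mat_of_cols n xs *\<^sub>v c + a \<cdot>\<^sub>v x"
      by (auto simp: mat_image_def)
    define c' where "c' = vec (Suc ?k) (\<lambda>i. if i < ?k then c $ i else a)"
    have "vec ?k (($) c') = c" using c(1) by (intro eq_vecI) (auto simp: c'_def)
    hence "v = mat_of_cols n (xs @ [x]) *\<^sub>v c'"
      using eq[of c'] c(2) by (simp add: c'_def)
    thus "v \<in> mat_image (mat_of_cols n (xs @ [x]))"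
      by (auto simp: mat_image_def c'_def intro!: imageI)
  qed
qed

text \<open>One Gram-Schmidt step per column: \<open>q = x - P x\<close> is the part of the new
  column orthogonal to the old span. If it vanishes, \<open>P\<close> still serves; otherwise the
  projection onto the line of \<open>q\<close> is added. Self-adjointness is carried along because
  it is what makes \<open>q\<close> orthogonal to the old span.\<close>

lemma orth_projection_cols:
  assumes "set xs \<subseteq> carrier_vec n"
  shows "\<exists>P\<in>carrier_mat n n. (\<forall>y\<in>carrier_vec n. P *\<^sub>v y \<in> mat_image (mat_of_cols n xs)) \<and>
    (\<forall>v\<in>mat_image (mat_of_cols n xs). P *\<^sub>v v = v) \<and>
    (\<forall>y\<in>carrier_vec n. \<forall>z\<in>carrier_vec n. (P *\<^sub>v y) \<bullet> z = y \<bullet> (P *\<^sub>v z))"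
  using assms
proof (induction xs rule: rev_induct)
  case Nil
  have "mat_of_cols n [] *\<^sub>v v = 0\<^sub>v n" if "v \<in> carrier_vec 0" for v :: "real vec"
    using that by (intro eq_vecI) (auto simp: scalar_prod_def)
  hence "mat_image (mat_of_cols n []) = {0\<^sub>v n}"
    unfolding mat_image_def by (auto intro!: image_eqI[of _ _ "0\<^sub>v 0"])
  moreover have "0\<^sub>m n n *\<^sub>v y = 0\<^sub>v n" if "y \<in> carrier_vec n" for y :: "real vec"
    using that by (intro eq_vecI) auto
  ultimately show ?case by (intro bexI[of _ "0\<^sub>m n n"]) auto
next
  case (snoc x xs)
  let ?V = "mat_image (mat_of_cols n xs)" and ?W = "mat_image (mat_of_cols n (xs @ [x]))"
  from snoc obtain P where P: "P \<in> carrier_mat n n" and im: "\<And>y. y \<in> carrier_vec n \<Longrightarrow> P *\<^sub>v y \<in> ?V"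
    and fx: "\<And>v. v \<in> ?V \<Longrightarrow> P *\<^sub>v v = v"
    and sym: "\<And>y z. y \<in> carrier_vec n \<Longrightarrow> z \<in> carrier_vec n \<Longrightarrow> (P *\<^sub>v y) \<bullet> z = y \<bullet> (P *\<^sub>v z)"
    and x: "x \<in> carrier_vec n" by auto
  have V: "v \<in> carrier_vec n" if "v \<in> ?V" for v
    using that mat_image_carrier[OF mat_of_cols_carrier(1)] by blast
  define q where "q = x - P *\<^sub>v x"
  have Px: "P *\<^sub>v x \<in> carrier_vec n" using P x by auto
  have q: "q \<in> carrier_vec n" using Px x by (auto simp: q_def)
  show ?case
  proof (cases "q = 0\<^sub>v n")
    case True
    have "P *\<^sub>v x = x" using True minus_vec_eq_zero_iff[OF x Px] by (simp add: q_def)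
    hence "P *\<^sub>v v = v" if v: "v \<in> ?W" for v
    proof -
      from v obtain y a where "y \<in> ?V" "v = y + a \<cdot>\<^sub>v x" unfolding mat_image_snoc[OF x] by blast
      thus ?thesis using \<open>P *\<^sub>v x = x\<close> V x fx
        by (simp add: mult_add_distrib_mat_vec[OF P] mult_mat_vec[OF P])
    qed
    moreover have "P *\<^sub>v y \<in> ?W" if "y \<in> carrier_vec n" for y
    proof -
      have "P *\<^sub>v y = P *\<^sub>v y + 0 \<cdot>\<^sub>v x"
        using P x by (intro eq_vecI) (auto simp del: index_mult_mat_vec)
      thus ?thesis unfolding mat_image_snoc[OF x] using im[OF that] by blast
    qed
    ultimately show ?thesis using P sym by blast
  next
    case False
    define \<alpha> where "\<alpha> = 1 / (q \<bullet> q)"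
    have qq: "q \<bullet> q \<noteq> 0" using scalar_prod_self_eq_0[OF q] False by blast
    define P' where "P' = P + outer (\<alpha> \<cdot>\<^sub>v q) q"
    have P': "P' \<in> carrier_mat n n" using P q by (auto simp: P'_def)
    have ac: "P' *\<^sub>v y = P *\<^sub>v y + (\<alpha> * (q \<bullet> y)) \<cdot>\<^sub>v q" if "y \<in> carrier_vec n" for y
      unfolding P'_def using that P q
      by (subst add_mult_distrib_mat_vec[of _ n n])
        (auto simp: outer_mult_vec[of q n] smult_smult_assoc ac_simps)
    have qV: "q \<bullet> v = 0" if "v \<in> ?V" for v
      unfolding q_def using minus_scalar_prod_distrib[OF x Px V[OF that]] sym[OF x V[OF that]] fx[OF that]
      by simp
    have "q \<bullet> x = q \<bullet> (q + P *\<^sub>v x)"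
      using P x Px by (intro arg_cong[of _ _ "\<lambda>v. q \<bullet> v"] eq_vecI) (auto simp: q_def simp del: index_mult_mat_vec)
    also have "\<dots> = q \<bullet> q" using scalar_prod_add_distrib[OF q q Px] qV[OF im[OF x]] by simp
    finally have qx: "q \<bullet> x = q \<bullet> q" .
    have "P' *\<^sub>v x = x"
      unfolding ac[OF x] qx \<alpha>_def using qq P x Px
      by (intro eq_vecI) (auto simp: q_def simp del: index_mult_mat_vec)
    moreover have "P' *\<^sub>v v = v" if "v \<in> ?V" for v
      unfolding ac[OF V[OF that]] qV[OF that] fx[OF that] using V[OF that] q by (intro eq_vecI) auto
    ultimately have "P' *\<^sub>v v = v" if v: "v \<in> ?W" for v
    proof -
      from v obtain y a where "y \<in> ?V" "v = y + a \<cdot>\<^sub>v x" unfolding mat_image_snoc[OF x] by blast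
      thus ?thesis using \<open>P' *\<^sub>v x = x\<close> V x \<open>\<And>v. v \<in> ?V \<Longrightarrow> P' *\<^sub>v v = v\<close>
        by (simp add: mult_add_distrib_mat_vec[OF P'] mult_mat_vec[OF P'])
    qed
    moreover have "P' *\<^sub>v y \<in> ?W" if y: "y \<in> carrier_vec n" for y
    proof -
      \<comment> \<open>Since \<open>q = x - P x\<close>, moving the multiple of \<open>x\<close>
        out of the correction leaves \<open>P (y - \<beta> x) + \<beta> x\<close>, a vector of the
        old image plus a multiple of the new column.\<close>
      define \<beta> where "\<beta> = \<alpha> * (q \<bullet> y)"
      have "P *\<^sub>v (y - \<beta> \<cdot>\<^sub>v x) = P *\<^sub>v y - \<beta> \<cdot>\<^sub>v (P *\<^sub>v x)"
        using x y P by (simp add: mult_minus_distrib_mat_vec[OF P] mult_mat_vec[OF P])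
      moreover have "P *\<^sub>v y \<in> carrier_vec n" using P y by auto
      ultimately have "P' *\<^sub>v y = P *\<^sub>v (y - \<beta> \<cdot>\<^sub>v x) + \<beta> \<cdot>\<^sub>v x"
        unfolding ac[OF y] \<beta>_def[symmetric] using P x Px y
        by (intro eq_vecI) (auto simp: q_def algebra_simps simp del: index_mult_mat_vec)
      moreover have "y - \<beta> \<cdot>\<^sub>v x \<in> carrier_vec n" using x y by auto
      ultimately show ?thesis unfolding mat_image_snoc[OF x] using im by blast
    qed
    moreover have "(P' *\<^sub>v y) \<bullet> z = y \<bullet> (P' *\<^sub>v z)" if y: "y \<in> carrier_vec n" and z: "z \<in> carrier_vec n" for y z
    proof -
      have "P *\<^sub>v y \<in> carrier_vec n" "P *\<^sub>v z \<in> carrier_vec n" using P y z by auto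
      thus ?thesis unfolding ac[OF y] ac[OF z] using q y z sym[OF y z] comm_scalar_prod[OF q y]
        by (simp add: add_scalar_prod_distrib[of _ n] scalar_prod_add_distrib[of _ n])
    qed
    ultimately show ?thesis using P' by blast
  qed
qed

lemma orth_projection:
  assumes X: "X \<in> carrier_mat n k"
  obtains P where "P \<in> carrier_mat n n" "\<And>y. y \<in> carrier_vec n \<Longrightarrow> P *\<^sub>v y \<in> mat_image X"
    "\<And>v. v \<in> mat_image X \<Longrightarrow> P *\<^sub>v v = v"
    "\<And>y z. y \<in> carrier_vec n \<Longrightarrow> z \<in> carrier_vec n \<Longrightarrow> (P *\<^sub>v y) \<bullet> z = y \<bullet> (P *\<^sub>v z)"
proof -
  have "set (cols X) \<subseteq> carrier_vec n" using X cols_dim[of X] by auto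
  moreover have "mat_of_cols n (cols X) = X" using X mat_of_cols_cols[of X] by auto
  ultimately show ?thesis using orth_projection_cols[of "cols X" n] that by auto
qed

text \<open>The residual of \<open>y\<close> under orthogonal projection annihilates the image, and
  its pairing with \<open>y\<close> is its own squared length.\<close>

lemma mat_image_separation:
  assumes X: "X \<in> carrier_mat n k" and y: "y \<in> carrier_vec n" and "y \<notin> mat_image X"
  obtains \<eta> where "\<eta> \<in> carrier_vec n" "\<eta> \<bullet> y \<noteq> 0" "\<And>v. v \<in> mat_image X \<Longrightarrow> \<eta> \<bullet> v = 0"
proof -
  from orth_projection[OF X] obtain P where P: "P \<in> carrier_mat n n"
    and im: "\<And>y. y \<in> carrier_vec n \<Longrightarrow> P *\<^sub>v y \<in> mat_image X"
    and fx: "\<And>v. v \<in> mat_image X \<Longrightarrow> P *\<^sub>v v = v"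
    and sym: "\<And>y z. y \<in> carrier_vec n \<Longrightarrow> z \<in> carrier_vec n \<Longrightarrow> (P *\<^sub>v y) \<bullet> z = y \<bullet> (P *\<^sub>v z)" by blast
  define \<eta> where "\<eta> = y - P *\<^sub>v y"
  have Py: "P *\<^sub>v y \<in> carrier_vec n" using P y by auto
  have \<eta>: "\<eta> \<in> carrier_vec n" using Py y by (auto simp: \<eta>_def)
  have orth: "\<eta> \<bullet> v = 0" if "v \<in> mat_image X" for v
    unfolding \<eta>_def using minus_scalar_prod_distrib[OF y Py mat_image_carrier[OF X that]]
      sym[OF y mat_image_carrier[OF X that]] fx[OF that] by simp
  have y_eq: "y = \<eta> + P *\<^sub>v y"
    using y Py P by (intro eq_vecI) (auto simp: \<eta>_def simp del: index_mult_mat_vec)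
  have "\<eta> \<noteq> 0\<^sub>v n"
  proof
    assume "\<eta> = 0\<^sub>v n"
    hence "y = P *\<^sub>v y" using y_eq Py by (metis left_zero_vec)
    thus False using im[OF y] assms(3) by simp
  qed
  moreover have "\<eta> \<bullet> y = \<eta> \<bullet> \<eta>"
    using scalar_prod_add_distrib[OF \<eta> \<eta> Py] orth[OF im[OF y]] y_eq by simp
  ultimately have "\<eta> \<bullet> y \<noteq> 0" using scalar_prod_self_eq_0[OF \<eta>] by auto
  thus ?thesis using that \<eta> orth by blast
qed

lemma rank_deficient_annihilator:
  assumes X: "X \<in> carrier_mat n k" and r: "vec_space.rank n X < n"
  obtains \<eta> :: "real vec" where "\<eta> \<in> carrier_vec n" "\<eta> \<noteq> 0\<^sub>v n" "\<And>v. v \<in> mat_image X \<Longrightarrow> \<eta> \<bullet> v = 0"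
proof -
  interpret vec_space "TYPE(real)" n .
  have "\<not> carrier_vec n \<subseteq> mat_image X"
  proof
    assume "carrier_vec n \<subseteq> mat_image X"
    hence "span (set (cols X)) = carrier_vec n"
      using col_space_eq[OF X] X unfolding col_space_def mat_image_def by auto
    \<comment> \<open>\<open>rank\<close> is the dimension of the space whose carrier is cut down to
      the column span; if that span is everything, the space is unchanged and the rank equals
      \<open>n\<close>.\<close>
    moreover have "V\<lparr>carrier := carrier_vec n\<rparr> = V" unfolding module_vec_def by simp
    ultimately have "rank X = dim" unfolding rank_def by metis
    thus False using r dim_is_n by simp
  qed
  then obtain y where "y \<in> carrier_vec n" "y \<notin> mat_image X" by blast
  from mat_image_separation[OF X this] obtain \<eta> where
    "\<eta> \<in> carrier_vec n" "\<eta> \<bullet> y \<noteq> 0" "\<And>v. v \<in> mat_image X \<Longrightarrow> \<eta> \<bullet> v = 0" by blast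
  thus ?thesis using that \<open>y \<in> carrier_vec n\<close> by (metis scalar_prod_left_zero)
qed

section \<open>Destabilizing perturbations\<close>

text \<open>Both matrices are perturbed along the same column \<open>a\<close>, so the data equation
  survives whenever \<open>g\<close> and \<open>q\<close> together annihilate the data. Although
  \<open>a\<close> can be made large in the direction \<open>f\<close>, a suitable gain reduces its
  effect on the closed loop to a small multiple of a fixed rank-one matrix, and openness of the
  Schur property applies.\<close>

lemma rank_one_perturbation_input:
  fixes A B K :: "real mat"
  assumes A: "A \<in> carrier_mat n n" and B: "B \<in> carrier_mat n m" and K: "K \<in> carrier_mat m n"
    and stable: "schur (A + B * K)"
    and g: "g \<in> carrier_vec n" and q: "q \<in> carrier_vec m" and "q \<noteq> 0\<^sub>v m"
    and f: "f \<in> carrier_vec n" and "f \<noteq> 0\<^sub>v n"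
  obtains a K' where "a \<in> carrier_vec n" "K' \<in> carrier_mat m n"
    "schur ((A + outer a g) + (B + outer a q) * K')" "f \<bullet> a \<ge> s"
proof -
  have "q \<bullet> q \<noteq> 0" "f \<bullet> f \<noteq> 0" using scalar_prod_self_eq_0 assms by blast+
  have "f \<bullet> f > 0"
    using \<open>f \<bullet> f \<noteq> 0\<close> by (simp add: scalar_prod_def sum_nonneg order.not_eq_order_implies_strict)
  \<comment> \<open>An input direction normalized by \<open>q \<bullet> e = 1\<close>, so that a
    feedback term along \<open>e\<close> enters the perturbed system through the column
    \<open>b + a\<close>.\<close>
  define e where "e = (1 / (q \<bullet> q)) \<cdot>\<^sub>v q"
  have e: "e \<in> carrier_vec m" and qe: "q \<bullet> e = 1"
    using q \<open>q \<bullet> q \<noteq> 0\<close> by (auto simp: e_def)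
  define b where "b = B *\<^sub>v e"
  have b: "b \<in> carrier_vec n" using B e by (auto simp: b_def)
  define k where "k = K\<^sup>T *\<^sub>v q"
  have k: "k \<in> carrier_vec n" using K q by (auto simp: k_def)
  define C where "C = B * K"
  have C: "C \<in> carrier_mat n n" using B K by (auto simp: C_def)
  have AC: "A + C \<in> carrier_mat n n" using A C by auto
  from schur_open[OF AC outer_carrier[OF f, of "g + k" n]] g k stable obtain \<delta> where
    \<delta>: "\<delta> > 0" "\<And>\<epsilon>. \<bar>\<epsilon>\<bar> < \<delta> \<Longrightarrow> schur (A + C + \<epsilon> \<cdot>\<^sub>m outer f (g + k))"
    unfolding C_def by auto
  \<comment> \<open>The sign makes \<open>\<epsilon> * (f \<bullet> f)\<close> push
    \<open>f \<bullet> b\<close> away from zero, so \<open>f \<bullet> c\<close> cannot vanish; the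
    size stays below \<open>\<delta>\<close>.\<close>
  define \<epsilon> where "\<epsilon> = (if f \<bullet> b \<ge> 0 then \<delta> / 2 else - \<delta> / 2)"
  define c where "c = b + \<epsilon> \<cdot>\<^sub>v f"
  have c: "c \<in> carrier_vec n" using b f by (auto simp: c_def)
  have fc: "f \<bullet> c = f \<bullet> b + \<epsilon> * (f \<bullet> f)"
    unfolding c_def using b f by (simp add: scalar_prod_add_distrib[of _ n])
  have "f \<bullet> c \<noteq> 0"
  proof (cases "f \<bullet> b \<ge> 0")
    case True
    hence "\<epsilon> * (f \<bullet> f) > 0" using \<delta>(1) \<open>f \<bullet> f > 0\<close> by (simp add: \<epsilon>_def)
    thus ?thesis using True fc by linarith
  next
    case False
    hence "\<epsilon> * (f \<bullet> f) < 0" using \<delta>(1) \<open>f \<bullet> f > 0\<close> by (simp add: \<epsilon>_def)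
    thus ?thesis using False fc by linarith
  qed
  \<comment> \<open>The maximum forces \<open>s' + f \<bullet> b \<ge> 1\<close>, hence
    \<open>\<mu> \<noteq> 0\<close>. The \<open>\<mu>\<close> chosen next gives
    \<open>f \<bullet> a = s'\<close>.\<close>
  define s' where "s' = max s (1 - f \<bullet> b)"
  define \<mu> where "\<mu> = (s' + f \<bullet> b) / (f \<bullet> c)"
  have "\<mu> \<noteq> 0" using \<open>f \<bullet> c \<noteq> 0\<close> by (auto simp: \<mu>_def s'_def)
  \<comment> \<open>With this \<open>a\<close> and the gain \<open>K'\<close> below, the closed loop is \<open>A + B K + \<epsilon> f (g + k)\<^sup>T\<close> for every \<open>\<mu>\<close>.\<close>
  define a where "a = \<mu> \<cdot>\<^sub>v c - b"
  have a: "a \<in> carrier_vec n" using b c by (auto simp: a_def)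
  have "f \<bullet> a = \<mu> * (f \<bullet> c) - f \<bullet> b"
    unfolding a_def using f b c by (simp add: scalar_prod_minus_distrib[of _ n])
  hence fa: "f \<bullet> a \<ge> s" using \<open>f \<bullet> c \<noteq> 0\<close> by (simp add: \<mu>_def s'_def)
  \<comment> \<open>The closed loop is \<open>A + B * K\<close> plus \<open>outer a (g + k)\<close>
    plus \<open>outer (b + a) h\<close>. As \<open>b + a\<close> is \<open>\<mu>\<close> times
    \<open>c\<close>, this \<open>h\<close> adds \<open>c - \<mu> c\<close> to the column
    \<open>a\<close> of \<open>outer a (g + k)\<close>, and what remains is \<open>c - b\<close>,
    that is \<open>\<epsilon>\<close> times \<open>f\<close>.\<close>
  define h where "h = (1 / \<mu> - 1) \<cdot>\<^sub>v (g + k)"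
  have h: "h \<in> carrier_vec n" using g k by (auto simp: h_def)
  define K' where "K' = K + outer e h"
  have K': "K' \<in> carrier_mat m n" using K e h by (auto simp: K'_def)
  have o: "outer a q \<in> carrier_mat n m" "outer e h \<in> carrier_mat m n" using a q e h by auto
  have "(B + outer a q) * K' = (B * K + outer a q * K) + (B * outer e h + outer a q * outer e h)"
    unfolding K'_def using B K o
    by (simp add: mult_add_distrib_mat[of _ n m] add_mult_distrib_mat[of _ n m])
  also have "outer a q * K = outer a k" unfolding k_def by (rule outer_mult[OF q K])
  also have "B * outer e h = outer b h" unfolding b_def by (rule mult_outer[OF B e])
  also have "outer a q * outer e h = outer a h"
    unfolding mult_outer[OF o(1) e] outer_mult_vec[OF q e] qe by simp
  finally have BK: "(B + outer a q) * K' = (C + outer a k) + (outer b h + outer a h)"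
    unfolding C_def .
  have "(A + outer a g) + (B + outer a q) * K' = A + C + \<epsilon> \<cdot>\<^sub>m outer f (g + k)"
    unfolding BK
  proof (rule eq_matI)
    fix i j assume "i < dim_row (A + C + \<epsilon> \<cdot>\<^sub>m outer f (g + k))" "j < dim_col (A + C + \<epsilon> \<cdot>\<^sub>m outer f (g + k))"
    hence ij: "i < n" "j < n" using f g k by auto
    have ai: "a $ i = \<mu> * (b $ i + \<epsilon> * f $ i) - b $ i" using ij b f c by (auto simp: a_def c_def)
    have hj: "h $ j = (1 / \<mu> - 1) * (g $ j + k $ j)" using ij g k by (auto simp: h_def)
    have "a $ i * g $ j + a $ i * k $ j + (b $ i * h $ j + a $ i * h $ j) = \<epsilon> * (f $ i * (g $ j + k $ j))"
      unfolding ai hj using \<open>\<mu> \<noteq> 0\<close> by (simp add: field_simps)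
    thus "((A + outer a g) + ((C + outer a k) + (outer b h + outer a h))) $$ (i, j) =
        (A + C + \<epsilon> \<cdot>\<^sub>m outer f (g + k)) $$ (i, j)"
      using ij A C a b f g k h by auto
  qed (use A C a b f g k h in auto)
  moreover have "\<bar>\<epsilon>\<bar> < \<delta>" using \<delta>(1) by (auto simp: \<epsilon>_def)
  ultimately have "schur ((A + outer a g) + (B + outer a q) * K')" using \<delta>(2) by simp
  thus ?thesis using that a K' fa by blast
qed

text \<open>Here \<open>l\<close> is the first index at which the functional \<open>\<eta>\<close>
  sees the input through \<open>A\<close>. The perturbed closed loop is made similar to
  \<open>A + B * K\<close> by a transformation \<open>S\<close> that fixes \<open>B\<close>, so it
  stays Schur however large \<open>s\<close> is.\<close>

lemma rank_one_perturbation_state: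
  fixes A B K :: "real mat" and \<eta> :: "real vec"
  defines "\<theta> \<equiv> \<lambda>i. ((\<lambda>v. A\<^sup>T *\<^sub>v v) ^^ i) \<eta>"
  assumes A: "A \<in> carrier_mat n n" and B: "B \<in> carrier_mat n m" and K: "K \<in> carrier_mat m n"
    and stable: "schur (A + B * K)"
    and \<eta>: "\<eta> \<in> carrier_vec n" and e: "e \<in> carrier_vec m"
    and zero: "\<And>i w. i < l \<Longrightarrow> w \<in> carrier_vec m \<Longrightarrow> \<theta> i \<bullet> (B *\<^sub>v w) = 0"
    and nonzero: "\<theta> l \<bullet> (B *\<^sub>v e) \<noteq> 0"
  obtains d K' where "d \<in> carrier_vec n" "K' \<in> carrier_mat m n"
    "schur ((A + outer d \<eta>) + B * K')" "\<eta> \<bullet> d = s"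
proof -
  define b where "b = B *\<^sub>v e"
  have b: "b \<in> carrier_vec n" using B e by (auto simp: b_def)
  define y where "y = (\<lambda>i. ((\<lambda>v. A *\<^sub>v v) ^^ i) b)"
  have y: "y i \<in> carrier_vec n" for i using A b by (induction i) (auto simp: y_def)
  have \<theta>: "\<theta> i \<in> carrier_vec n" for i using A \<eta> by (induction i) (auto simp: \<theta>_def)
  have y_Suc: "y (Suc i) = A *\<^sub>v y i" and \<theta>_Suc: "\<theta> (Suc i) = A\<^sup>T *\<^sub>v \<theta> i" for i
    by (simp_all add: y_def \<theta>_def)
  \<comment> \<open>These are the Markov parameters of input direction \<open>e\<close> and output
    \<open>\<eta>\<close>. Powers of \<open>A\<close> move freely across the pairing, so
    \<open>\<theta> i \<bullet> y j\<close> depends only on \<open>i + j\<close>; the sequence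
    vanishes below \<open>l\<close> and is nonzero at \<open>l\<close>.\<close>
  define \<gamma> where "\<gamma> = (\<lambda>i. \<theta> i \<bullet> b)"
  have \<theta>y: "\<theta> i \<bullet> y j = \<gamma> (i + j)" for i j
  proof (induction j arbitrary: i)
    case (Suc j)
    have "\<theta> i \<bullet> y (Suc j) = \<theta> (Suc i) \<bullet> y j"
      unfolding y_Suc \<theta>_Suc using transpose_vec_mult_scalar[OF A y \<theta>] by simp
    thus ?case using Suc by simp
  qed (simp add: \<gamma>_def y_def)
  have \<gamma>0: "\<gamma> i = 0" if "i < l" for i using zero[OF that e] by (simp add: \<gamma>_def b_def)
  have \<gamma>l: "\<gamma> l \<noteq> 0" using nonzero by (simp add: \<gamma>_def b_def)
  define \<sigma> where "\<sigma> = s / \<gamma> l"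
  \<comment> \<open>\<open>Z\<close> is chosen so that \<open>A Z - Z A\<close> telescopes to \<open>y\<^sub>l \<eta>\<^sup>T - b \<theta>\<^sub>l\<^sup>T\<close>. Hence \<open>S = 1 + \<sigma> Z\<close>
    conjugates \<open>A\<close> to a state perturbation plus a feedback term, and it fixes \<open>B\<close> since \<open>Z B = 0\<close>.\<close>
  define Z where "Z = mat n n (\<lambda>(r, c). \<Sum>i<l. y (l - 1 - i) $ r * \<theta> i $ c)"
  have Z: "Z \<in> carrier_mat n n" by (simp add: Z_def)
  have Z_vec: "(Z *\<^sub>v v) $ r = (\<Sum>i<l. y (l - 1 - i) $ r * (\<theta> i \<bullet> v))"
    if "v \<in> carrier_vec n" "r < n" for v r
  proof -
    have "(Z *\<^sub>v v) $ r = (\<Sum>c<n. \<Sum>i<l. y (l - 1 - i) $ r * \<theta> i $ c * v $ c)"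
      using that by (simp add: Z_def scalar_prod_def lessThan_atLeast0 sum_distrib_right)
    also have "\<dots> = (\<Sum>i<l. \<Sum>c<n. y (l - 1 - i) $ r * \<theta> i $ c * v $ c)" by (rule sum.swap)
    finally show ?thesis
      using that by (simp add: scalar_prod_def lessThan_atLeast0 sum_distrib_left ac_simps)
  qed
  have \<theta>Z: "\<phi> \<bullet> (Z *\<^sub>v v) = (\<Sum>i<l. (\<phi> \<bullet> y (l - 1 - i)) * (\<theta> i \<bullet> v))"
    if "\<phi> \<in> carrier_vec n" "v \<in> carrier_vec n" for \<phi> v
  proof -
    have "\<phi> \<bullet> (Z *\<^sub>v v) = (\<Sum>r<n. \<phi> $ r * (Z *\<^sub>v v) $ r)"
      using that Z by (simp add: scalar_prod_def lessThan_atLeast0)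
    also have "\<dots> = (\<Sum>r<n. \<phi> $ r * (\<Sum>i<l. y (l - 1 - i) $ r * (\<theta> i \<bullet> v)))"
      using Z_vec[OF that(2)] by (intro sum.cong) auto
    also have "\<dots> = (\<Sum>r<n. \<Sum>i<l. \<phi> $ r * (y (l - 1 - i) $ r * (\<theta> i \<bullet> v)))"
      by (simp add: sum_distrib_left)
    also have "\<dots> = (\<Sum>i<l. \<Sum>r<n. \<phi> $ r * (y (l - 1 - i) $ r * (\<theta> i \<bullet> v)))" by (rule sum.swap)
    also have "\<dots> = (\<Sum>i<l. (\<phi> \<bullet> y (l - 1 - i)) * (\<theta> i \<bullet> v))"
    proof (rule sum.cong[OF refl])
      fix i
      have "dim_vec (y (l - 1 - i)) = n" using y by auto
      thus "(\<Sum>r<n. \<phi> $ r * (y (l - 1 - i) $ r * (\<theta> i \<bullet> v))) = (\<phi> \<bullet> y (l - 1 - i)) * (\<theta> i \<bullet> v)"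
        unfolding scalar_prod_def[of \<phi>] by (simp add: lessThan_atLeast0 sum_distrib_right mult.assoc)
    qed
    finally show ?thesis .
  qed
  define S where "S = 1\<^sub>m n + \<sigma> \<cdot>\<^sub>m Z"
  have S: "S \<in> carrier_mat n n" using Z by (auto simp: S_def)
  have S_vec: "S *\<^sub>v v = v + \<sigma> \<cdot>\<^sub>v (Z *\<^sub>v v)" if "v \<in> carrier_vec n" for v
    unfolding S_def using that Z smult_mat_mult_vec[of Z v \<sigma>]
    by (subst add_mult_distrib_mat_vec[of _ n n]) auto
  have \<theta>S: "\<phi> \<bullet> (S *\<^sub>v v) = \<phi> \<bullet> v + \<sigma> * (\<phi> \<bullet> (Z *\<^sub>v v))"
    if "\<phi> \<in> carrier_vec n" "v \<in> carrier_vec n" for \<phi> v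
    unfolding S_vec[OF that(2)] using that Z by (simp add: scalar_prod_add_distrib[of _ n])
  \<comment> \<open>For \<open>v\<close> in the kernel of \<open>S\<close>, induction on
    \<open>j\<close> shows \<open>\<theta> j \<bullet> v = 0\<close> for \<open>j < l\<close>. In
    the expansion of \<open>\<theta> j \<bullet> (Z v)\<close> the terms with \<open>i < j\<close>
    vanish by induction, and those with \<open>i \<ge> j\<close> carry a Markov parameter of index
    below \<open>l\<close>. Hence \<open>Z v = 0\<close> and \<open>v = S v = 0\<close>.\<close>
  have "det S \<noteq> 0"
  proof
    assume "det S = 0"
    then obtain v where v: "v \<in> carrier_vec n" "v \<noteq> 0\<^sub>v n" "S *\<^sub>v v = 0\<^sub>v n"
      using det_0_iff_vec_prod_zero[OF S] by blast
    have \<theta>v: "\<theta> j \<bullet> v = 0" if "j < l" for j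
      using that
    proof (induction j rule: less_induct)
      case (less j)
      have "(\<theta> j \<bullet> y (l - 1 - i)) * (\<theta> i \<bullet> v) = 0" if "i < l" for i
      proof (cases "i < j")
        case True
        thus ?thesis using less.IH that by simp
      next
        case False
        thus ?thesis using \<theta>y \<gamma>0 that by simp
      qed
      hence "\<theta> j \<bullet> (Z *\<^sub>v v) = 0" unfolding \<theta>Z[OF \<theta> v(1)] by (intro sum.neutral) auto
      thus ?case using \<theta>S[OF \<theta> v(1), of j] v(3) \<theta>[of j] by simp
    qed
    have "Z *\<^sub>v v = 0\<^sub>v n" using Z Z_vec[OF v(1)] \<theta>v by (intro eq_vecI) auto
    hence "S *\<^sub>v v = v" using S_vec[OF v(1)] v(1) by (auto intro!: eq_vecI)
    thus False using v by simp
  qed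
  have ZB: "Z *\<^sub>v (B *\<^sub>v w) = 0\<^sub>v n" if "w \<in> carrier_vec m" for w
  proof (rule eq_vecI)
    have "B *\<^sub>v w \<in> carrier_vec n" using B that by auto
    thus "(Z *\<^sub>v (B *\<^sub>v w)) $ r = 0\<^sub>v n $ r" if "r < dim_vec (0\<^sub>v n)" for r
      using that zero \<open>w \<in> carrier_vec m\<close> by (subst Z_vec) auto
  qed (use Z in auto)
  have SB: "S * B = B"
  proof (rule mat_eq_by_vec[of _ n m])
    fix w :: "real vec" assume w: "w \<in> carrier_vec m"
    hence Bw: "B *\<^sub>v w \<in> carrier_vec n" using B by auto
    show "(S * B) *\<^sub>v w = B *\<^sub>v w"
      unfolding assoc_mult_mat_vec[OF S B w] S_vec[OF Bw] ZB[OF w] using Bw B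
      by (intro eq_vecI) (auto simp del: index_mult_mat_vec)
  qed (use S B in auto)
  have comm: "(A * Z) $$ (r, c) + b $ r * \<theta> l $ c = (Z * A) $$ (r, c) + y l $ r * \<eta> $ c"
    if rc: "r < n" "c < n" for r c
  proof -
    \<comment> \<open>Applying \<open>A\<close> on the left raises the power in \<open>y\<close>, on
      the right the power in \<open>\<theta>\<close>; so both products are sums of \<open>f\<close>,
      shifted against each other by one.\<close>
    define f where "f = (\<lambda>i. y (l - i) $ r * \<theta> i $ c)"
    have "(A * Z) $$ (r, c) = (\<Sum>k<n. \<Sum>i<l. A $$ (r, k) * (y (l - 1 - i) $ k * \<theta> i $ c))"
      using rc A by (simp add: Z_def scalar_prod_def lessThan_atLeast0 sum_distrib_left)
    also have "\<dots> = (\<Sum>i<l. \<Sum>k<n. A $$ (r, k) * (y (l - 1 - i) $ k * \<theta> i $ c))" by (rule sum.swap)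
    also have "\<dots> = (\<Sum>i<l. f i)"
    proof (rule sum.cong[OF refl])
      fix i assume "i \<in> {..<l}"
      hence "l - i = Suc (l - 1 - i)" by auto
      hence "y (l - i) $ r = (\<Sum>k<n. A $$ (r, k) * y (l - 1 - i) $ k)"
        using y_Suc[of "l - 1 - i"] A rc y[of "l - 1 - i"]
        by (simp add: scalar_prod_def lessThan_atLeast0)
      thus "(\<Sum>k<n. A $$ (r, k) * (y (l - 1 - i) $ k * \<theta> i $ c)) = f i"
        by (simp add: f_def sum_distrib_right mult.assoc)
    qed
    finally have 1: "(A * Z) $$ (r, c) = (\<Sum>i<l. f i)" .
    have "(Z * A) $$ (r, c) = (\<Sum>k<n. \<Sum>i<l. y (l - 1 - i) $ r * \<theta> i $ k * A $$ (k, c))"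
      using rc A by (simp add: Z_def scalar_prod_def lessThan_atLeast0 sum_distrib_right)
    also have "\<dots> = (\<Sum>i<l. \<Sum>k<n. y (l - 1 - i) $ r * \<theta> i $ k * A $$ (k, c))" by (rule sum.swap)
    also have "\<dots> = (\<Sum>i<l. f (Suc i))"
    proof (rule sum.cong[OF refl])
      fix i
      have "\<theta> (Suc i) $ c = (\<Sum>k<n. \<theta> i $ k * A $$ (k, c))"
        using \<theta>_Suc[of i] A rc \<theta>[of i] by (simp add: scalar_prod_def lessThan_atLeast0 ac_simps)
      thus "(\<Sum>k<n. y (l - 1 - i) $ r * \<theta> i $ k * A $$ (k, c)) = f (Suc i)"
        by (simp add: f_def sum_distrib_left mult.assoc)
    qed
    finally have 2: "(Z * A) $$ (r, c) = (\<Sum>i<l. f (Suc i))" .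
    have "(\<Sum>i<l. f (Suc i)) - (\<Sum>i<l. f i) = f l - f 0"
      unfolding sum_subtractf[symmetric] by (rule sum_lessThan_telescope)
    moreover have "f 0 = y l $ r * \<eta> $ c" "f l = b $ r * \<theta> l $ c"
      by (simp_all add: f_def y_def \<theta>_def)
    ultimately show ?thesis unfolding 1 2 by linarith
  qed
  have \<sigma>y: "\<sigma> \<cdot>\<^sub>v y l \<in> carrier_vec n" using y by auto
  \<comment> \<open>Solving for \<open>d\<close> through \<open>S\<close> makes the state
    perturbation become exactly the term with \<open>y l\<close> and \<open>\<eta>\<close> in
    \<open>comm\<close>. Since \<open>\<eta>\<close> annihilates the range of \<open>Z\<close>,
    \<open>\<eta> \<bullet> d = \<sigma> * \<gamma> l\<close>, which explains the choice of
    \<open>\<sigma>\<close>.\<close>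
  from mat_surj_if_inj[OF S \<open>det S \<noteq> 0\<close> \<sigma>y] obtain d where
    d: "d \<in> carrier_vec n" and Sd: "S *\<^sub>v d = \<sigma> \<cdot>\<^sub>v y l" by blast
  have \<theta>0: "\<theta> 0 = \<eta>" by (simp add: \<theta>_def)
  have "\<eta> \<bullet> (Z *\<^sub>v d) = 0"
    unfolding \<theta>Z[OF \<eta> d] using \<theta>y[of 0] \<gamma>0 by (intro sum.neutral) (auto simp: \<theta>0)
  hence "\<eta> \<bullet> d = \<eta> \<bullet> (S *\<^sub>v d)" using \<theta>S[OF \<eta> d] by simp
  also have "\<dots> = \<sigma> * \<gamma> l" unfolding Sd using \<theta>y[of 0 l] \<eta> y[of l] by (simp add: \<theta>0)
  finally have \<eta>d: "\<eta> \<bullet> d = s" using \<gamma>l by (simp add: \<sigma>_def)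
  \<comment> \<open>The part \<open>outer e k\<close> of \<open>K'\<close> supplies the remaining
    term of \<open>comm\<close>, the product of \<open>b\<close> and \<open>\<theta> l\<close>
    scaled by \<open>- \<sigma>\<close>. The part \<open>K * S\<close> contributes
    \<open>B * K * S\<close>, because \<open>S * B = B\<close>.\<close>
  define k where "k = (- \<sigma>) \<cdot>\<^sub>v \<theta> l"
  have k: "k \<in> carrier_vec n" using \<theta> by (auto simp: k_def)
  define K' where "K' = outer e k + K * S"
  have K': "K' \<in> carrier_mat m n" using e k K S by (auto simp: K'_def)
  define N where "N = (A + outer d \<eta>) + B * K'"
  have N: "N \<in> carrier_mat n n" using A d \<eta> B K' by (auto simp: N_def)
  define BKS where "BKS = B * K * S"
  have BKS: "BKS \<in> carrier_mat n n" using B K S by (auto simp: BKS_def)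
  have "S * N = S * (A + outer d \<eta>) + S * (B * K')"
    unfolding N_def by (rule mult_add_distrib_mat[OF S]) (use A d \<eta> B K' in auto)
  also have "S * (A + outer d \<eta>) = S * A + S * outer d \<eta>"
    by (rule mult_add_distrib_mat[OF S A]) (use d \<eta> in auto)
  also have "S * outer d \<eta> = outer (\<sigma> \<cdot>\<^sub>v y l) \<eta>" unfolding mult_outer[OF S d] Sd ..
  also have "S * (B * K') = B * K'" using assoc_mult_mat[OF S B K'] SB by simp
  also have "B * K' = B * outer e k + B * (K * S)"
    unfolding K'_def by (rule mult_add_distrib_mat[OF B]) (use e k K S in auto)
  also have "B * outer e k = outer b k" unfolding b_def by (rule mult_outer[OF B e])
  also have "B * (K * S) = BKS" unfolding BKS_def using assoc_mult_mat[OF B K S] by simp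
  also have "S * A = A + \<sigma> \<cdot>\<^sub>m (Z * A)"
    unfolding S_def using A Z by (subst add_mult_distrib_mat[of _ n n]) auto
  finally have SN: "S * N = (A + \<sigma> \<cdot>\<^sub>m (Z * A) + outer (\<sigma> \<cdot>\<^sub>v y l) \<eta>) + (outer b k + BKS)" .
  have "A * S = A + \<sigma> \<cdot>\<^sub>m (A * Z)"
    unfolding S_def using A Z by (subst mult_add_distrib_mat[of _ n n]) auto
  hence MS: "(A + B * K) * S = A + \<sigma> \<cdot>\<^sub>m (A * Z) + BKS"
    unfolding BKS_def using A B K S by (subst add_mult_distrib_mat[of _ n n]) auto
  have AZ: "A * Z \<in> carrier_mat n n" "Z * A \<in> carrier_mat n n" using A Z by auto
  have "S * N = (A + B * K) * S"
    unfolding SN MS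
  proof (rule eq_matI)
    fix r c assume "r < dim_row (A + \<sigma> \<cdot>\<^sub>m (A * Z) + BKS)" "c < dim_col (A + \<sigma> \<cdot>\<^sub>m (A * Z) + BKS)"
    hence rc: "r < n" "c < n" using BKS by auto
    have "\<sigma> * ((A * Z) $$ (r, c) + b $ r * \<theta> l $ c) = \<sigma> * ((Z * A) $$ (r, c) + y l $ r * \<eta> $ c)"
      using comm[OF rc] by simp
    hence "\<sigma> * (Z * A) $$ (r, c) + \<sigma> * y l $ r * \<eta> $ c + b $ r * (- \<sigma> * \<theta> l $ c) = \<sigma> * (A * Z) $$ (r, c)"
      by (simp add: algebra_simps)
    thus "((A + \<sigma> \<cdot>\<^sub>m (Z * A) + outer (\<sigma> \<cdot>\<^sub>v y l) \<eta>) + (outer b k + BKS)) $$ (r, c) =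
        (A + \<sigma> \<cdot>\<^sub>m (A * Z) + BKS) $$ (r, c)"
      using rc A AZ BKS y[of l] \<eta> b k \<theta>[of l] by (simp add: k_def del: index_mult_mat)
  qed (use A AZ BKS y[of l] \<eta> b k in auto)
  moreover have "A + B * K \<in> carrier_mat n n" using A B K by auto
  ultimately have "schur N" using schur_intertwined[OF _ N S \<open>det S \<noteq> 0\<close>] stable by blast
  thus ?thesis using that d K' \<eta>d unfolding N_def by blast
qed

section \<open>Invariant subspaces\<close>

text \<open>Let V be the range of \<open>P\<close>. As \<open>z\<close> is no eigenvalue of
  \<open>N'\<close>, the map \<open>N' - z\<close> is injective; it preserves V, hence maps V onto
  V. It sends \<open>v\<close> to \<open>(N' - N) v\<close>, which lies in V, so \<open>v\<close>
  itself lies in V, where \<open>N\<close> and \<open>N0\<close> agree.\<close>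

lemma eigenvector_restriction_or_quotient:
  fixes N N' N0 P :: "'a::field mat"
  assumes N: "N \<in> carrier_mat n n" and N': "N' \<in> carrier_mat n n" and N0: "N0 \<in> carrier_mat n n"
    and P: "P \<in> carrier_mat n n" and PP: "P * P = P"
    and NP: "N * P = N0 * P" and PNP: "P * (N * P) = N * P" and PN': "P * (N' - N) = N' - N"
    and v: "v \<in> carrier_vec n" "v \<noteq> 0\<^sub>v n" "N *\<^sub>v v = z \<cdot>\<^sub>v v"
    and none: "\<And>w. w \<in> carrier_vec n \<Longrightarrow> N' *\<^sub>v w = z \<cdot>\<^sub>v w \<Longrightarrow> w = 0\<^sub>v n"
  shows "N0 *\<^sub>v v = z \<cdot>\<^sub>v v"
proof -
  have Pc: "P *\<^sub>v x \<in> carrier_vec n" if "x \<in> carrier_vec n" for x using P that by auto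
  have PPv: "P *\<^sub>v (P *\<^sub>v x) = P *\<^sub>v x" if "x \<in> carrier_vec n" for x
    using assoc_mult_mat_vec[OF P P that] PP by simp
  define G where "G = N' - z \<cdot>\<^sub>m 1\<^sub>m n"
  have G: "G \<in> carrier_mat n n" using N' by (auto simp: G_def)
  have G_vec: "G *\<^sub>v x = N' *\<^sub>v x - z \<cdot>\<^sub>v x" if "x \<in> carrier_vec n" for x
    unfolding G_def using that N' smult_mat_mult_vec[of "1\<^sub>m n" x z]
    by (subst minus_mult_distrib_mat_vec[of _ n n]) auto
  have G_inj: "x = 0\<^sub>v n" if "x \<in> carrier_vec n" "G *\<^sub>v x = 0\<^sub>v n" for x
  proof -
    have c: "N' *\<^sub>v x \<in> carrier_vec n" using N' that by auto
    have "N' *\<^sub>v x = z \<cdot>\<^sub>v x"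
      using that(2) c that(1) unfolding G_vec[OF that(1)]
      by (subst (asm) minus_vec_eq_zero_iff) auto
    thus ?thesis using none that by blast
  qed
  have D_vec: "P *\<^sub>v ((N' - N) *\<^sub>v x) = (N' - N) *\<^sub>v x" if "x \<in> carrier_vec n" for x
    using assoc_mult_mat_vec[OF P _ that, of "N' - N"] minus_carrier_mat[OF N] PN' by simp
  have PNP_vec: "P *\<^sub>v (N *\<^sub>v (P *\<^sub>v x)) = N *\<^sub>v (P *\<^sub>v x)" if "x \<in> carrier_vec n" for x
  proof -
    have "N * P \<in> carrier_mat n n" using N P by auto
    thus ?thesis
      using assoc_mult_mat_vec[OF P _ that, of "N * P"] assoc_mult_mat_vec[OF N P that] PNP by simp
  qed
  have split: "G *\<^sub>v x = (N' - N) *\<^sub>v x + (N *\<^sub>v x - z \<cdot>\<^sub>v x)" if "x \<in> carrier_vec n" for x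
  proof -
    have "N' *\<^sub>v x \<in> carrier_vec n" "N *\<^sub>v x \<in> carrier_vec n" using N N' that by auto
    thus ?thesis unfolding G_vec[OF that] minus_mult_distrib_mat_vec[OF N' N that]
      using that N N' by (intro eq_vecI) (auto simp del: index_mult_mat_vec)
  qed
  \<comment> \<open>By \<open>split\<close>, \<open>G\<close> is the sum of \<open>N - z\<close> and
    \<open>N' - N\<close>: the first preserves the range of \<open>P\<close> and the second maps
    everything into it.\<close>
  have PG: "P *\<^sub>v (G *\<^sub>v (P *\<^sub>v x)) = G *\<^sub>v (P *\<^sub>v x)" if x: "x \<in> carrier_vec n" for x
  proof -
    have "N' - N \<in> carrier_mat n n" using N by (rule minus_carrier_mat)
    hence c: "(N' - N) *\<^sub>v (P *\<^sub>v x) \<in> carrier_vec n" "N *\<^sub>v (P *\<^sub>v x) \<in> carrier_vec n" "P *\<^sub>v x \<in> carrier_vec n"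
      using N N' Pc[OF x] by auto
    show ?thesis
      unfolding split[OF Pc[OF x]] using c
      by (simp add: mult_add_distrib_mat_vec[OF P] mult_minus_distrib_mat_vec[OF P] mult_mat_vec[OF P]
        D_vec PNP_vec[OF x] PPv[OF x])
  qed
  \<comment> \<open>\<open>Q\<close> is injective, hence onto, so every vector of the image of \<open>P\<close> is \<open>G\<close> of a vector of that image.\<close>
  define Q where "Q = G * P + (1\<^sub>m n - P)"
  have Q: "Q \<in> carrier_mat n n" using G P by (auto simp: Q_def)
  have Q_vec: "Q *\<^sub>v x = G *\<^sub>v (P *\<^sub>v x) + (x - P *\<^sub>v x)" if "x \<in> carrier_vec n" for x
    unfolding Q_def using G P that
    by (subst add_mult_distrib_mat_vec[of _ n n]) (auto simp: minus_mult_distrib_mat_vec[of _ n n])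
  have PQ: "P *\<^sub>v (Q *\<^sub>v x) = G *\<^sub>v (P *\<^sub>v x)" if x: "x \<in> carrier_vec n" for x
  proof -
    have "G *\<^sub>v (P *\<^sub>v x) \<in> carrier_vec n" using G Pc[OF x] by auto
    thus ?thesis
      unfolding Q_vec[OF x] using x Pc[OF x]
      by (simp add: mult_add_distrib_mat_vec[OF P] mult_minus_distrib_mat_vec[OF P] PPv[OF x] PG[OF x])
  qed
  have "det Q \<noteq> 0"
  proof
    assume "det Q = 0"
    then obtain x where x: "x \<in> carrier_vec n" "x \<noteq> 0\<^sub>v n" "Q *\<^sub>v x = 0\<^sub>v n"
      using det_0_iff_vec_prod_zero_field[OF Q] by blast
    have "P *\<^sub>v 0\<^sub>v n = 0\<^sub>v n" using P by auto
    hence "G *\<^sub>v (P *\<^sub>v x) = 0\<^sub>v n" using PQ[OF x(1)] x(3) by simp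
    hence "P *\<^sub>v x = 0\<^sub>v n" "G *\<^sub>v (P *\<^sub>v x) = 0\<^sub>v n" using G_inj Pc[OF x(1)] by auto
    hence "Q *\<^sub>v x = x" using Q_vec[OF x(1)] x(1) by (simp add: left_zero_vec)
    thus False using x by simp
  qed
  moreover have "(N' - N) *\<^sub>v v \<in> carrier_vec n"
    using mult_mat_vec_carrier[OF minus_carrier_mat[OF N] v(1)] .
  ultimately obtain x where x: "x \<in> carrier_vec n" "Q *\<^sub>v x = (N' - N) *\<^sub>v v"
    using mat_surj_if_inj[OF Q] by blast
  \<comment> \<open>The vectors \<open>v\<close> and \<open>P x\<close> have the same image under
    the injective \<open>G\<close>, so \<open>v\<close> lies in the range of
    \<open>P\<close>.\<close>
  have "G *\<^sub>v v = (N' - N) *\<^sub>v v"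
    unfolding split[OF v(1)] v(3) using v(1) \<open>(N' - N) *\<^sub>v v \<in> carrier_vec n\<close> by simp
  also have "\<dots> = P *\<^sub>v (Q *\<^sub>v x)" using D_vec[OF v(1)] x(2) by simp
  finally have "G *\<^sub>v v = G *\<^sub>v (P *\<^sub>v x)" using PQ[OF x(1)] by simp
  moreover have "G *\<^sub>v v \<in> carrier_vec n" using G v by auto
  ultimately have "G *\<^sub>v (v - P *\<^sub>v x) = 0\<^sub>v n"
    unfolding mult_minus_distrib_mat_vec[OF G v(1) Pc[OF x(1)]] by simp
  hence zero: "v - P *\<^sub>v x = 0\<^sub>v n" using G_inj v(1) Pc[OF x(1)] by auto
  hence "v = P *\<^sub>v x" using minus_vec_eq_zero_iff[OF v(1) Pc[OF x(1)]] by simp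
  hence "P *\<^sub>v v = v" using PPv[OF x(1)] by simp
  hence "N *\<^sub>v v = N0 *\<^sub>v v"
    using assoc_mult_mat_vec[OF N P v(1)] assoc_mult_mat_vec[OF N0 P v(1)] NP by simp
  thus ?thesis using v(3) by simp
qed

text \<open>\<open>N\<close> behaves like \<open>N0\<close> on the range of \<open>P\<close> and
  like \<open>N'\<close> modulo that range, so each of its eigenvalues comes from one of the two.
  Encoding the invariant subspace by identities for \<open>P\<close> lets everything pass to complex
  matrices entrywise.\<close>

lemma schur_restriction_quotient:
  assumes N: "N \<in> carrier_mat n n" and N': "N' \<in> carrier_mat n n" and N0: "N0 \<in> carrier_mat n n"
    and P: "P \<in> carrier_mat n n" and "P * P = P"
    and "N * P = N0 * P" and "P * (N * P) = N * P" and "P * (N' - N) = N' - N"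
    and "schur N0" "schur N'"
  shows "schur N"
proof (rule schurI[OF N])
  let ?h = "map_mat complex_of_real"
  fix z :: complex and v :: "complex vec"
  assume v: "v \<in> carrier_vec n" "v \<noteq> 0\<^sub>v n" "?h N *\<^sub>v v = z \<cdot>\<^sub>v v"
  show "cmod z < 1"
  proof (rule ccontr)
    assume z: "\<not> cmod z < 1"
    have NP: "N * P \<in> carrier_mat n n" and D: "N' - N \<in> carrier_mat n n" using N P N' by auto
    have hD: "?h (N' - N) = ?h N' - ?h N" using N N' by (intro eq_matI) auto
    have "?h N0 *\<^sub>v v = z \<cdot>\<^sub>v v"
    proof (rule eigenvector_restriction_or_quotient[of "?h N" n "?h N'" "?h N0" "?h P"])
      show "?h P * ?h P = ?h P" using assms(5) P of_real_hom.mat_hom_mult[OF P P] by metis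
      show "?h N * ?h P = ?h N0 * ?h P"
        using assms(6) of_real_hom.mat_hom_mult[OF N P] of_real_hom.mat_hom_mult[OF N0 P] by metis
      show "?h P * (?h N * ?h P) = ?h N * ?h P"
        using assms(7) of_real_hom.mat_hom_mult[OF N P] of_real_hom.mat_hom_mult[OF P NP] by metis
      show "?h P * (?h N' - ?h N) = ?h N' - ?h N"
        using assms(8) of_real_hom.mat_hom_mult[OF P D] hD by metis
      show "w = 0\<^sub>v n" if "w \<in> carrier_vec n" "?h N' *\<^sub>v w = z \<cdot>\<^sub>v w" for w
        using schurD[OF assms(10) N' that(1) _ that(2)] z by blast
    qed (use N N' N0 P v in auto)
    thus False using schurD[OF assms(9) N0 v(1,2)] z by blast
  qed
qed

section \<open>The informativity criterion\<close>

theorem theorem15: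
  fixes n m T :: nat
    and A_true B_true :: "real mat"
    and u x :: "nat \<Rightarrow> real vec"
  assumes "n > 0" and "m > 0" and "T > 0"
    and "(A_true, B_true) \<in> systems n m"
    and "\<And>t. t < T \<Longrightarrow> u t \<in> carrier_vec m"
    and "\<And>t. t \<le> T \<Longrightarrow> x t \<in> carrier_vec n"
    and "\<And>t. t < T \<Longrightarrow> x (t + 1) = A_true *\<^sub>v x t + B_true *\<^sub>v u t"
    and "(A_true, B_true) \<in> Sigma_stab n m"
    and "vec_space.rank n (X_minus n T x) < n"
  shows "informative_for_stabilization (Sigma_stab n m) n m T u x \<longleftrightarrow>
    mat_image (X_plus n T x) \<subseteq> mat_image (X_minus n T x) \<and>
    mat_image (X_minus n T x @\<^sub>r U_minus m T u)
      = stacked_product (mat_image (X_minus n T x)) (carrier_vec m)"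
proof -

  \<comment> \<open>The data equation in terms of coefficient vectors\<close>
  define A B X U Xp where "A = A_true" and "B = B_true"
    and "X = X_minus n T x" and "U = U_minus m T u" and "Xp = X_plus n T x"
  note defs = A_def B_def X_def U_def Xp_def
  have A: "A \<in> carrier_mat n n" and B: "B \<in> carrier_mat n m"
    using assms(4) by (auto simp: systems_def defs)
  have X: "X \<in> carrier_mat n T" and U: "U \<in> carrier_mat m T" and Xp: "Xp \<in> carrier_mat n T"
    by (auto simp: defs X_minus_def U_minus_def X_plus_def)
  have x: "x t \<in> carrier_vec n" if "t \<le> T" for t using assms(6) that .
  have u: "u t \<in> carrier_vec m" if "t < T" for t using assms(5) that .
  have step: "x (Suc t) = A *\<^sub>v x t + B *\<^sub>v u t" if "t < T" for t
    using assms(7)[OF that] by (simp add: defs)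
  have Xc: "\<phi> \<bullet> (X *\<^sub>v c) = (\<Sum>t<T. c $ t * (\<phi> \<bullet> x t))"
    if "\<phi> \<in> carrier_vec n" "c \<in> carrier_vec T" for \<phi> c
    unfolding X_def X_minus_def using that x by (intro mat_of_cols_map_scalar_prod) auto
  have Xp_eq: "Xp = mat_of_cols n (map (\<lambda>t. x (Suc t)) [0..<T])"
    unfolding Xp_def X_plus_def
    by (rule arg_cong[where f = "mat_of_cols n"], rule nth_equalityI) (auto simp del: upt_Suc)
  have Xpc: "\<phi> \<bullet> (Xp *\<^sub>v c) = (\<Sum>t<T. c $ t * (\<phi> \<bullet> x (Suc t)))"
    if "\<phi> \<in> carrier_vec n" "c \<in> carrier_vec T" for \<phi> c
    unfolding Xp_eq using that x by (intro mat_of_cols_map_scalar_prod) auto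
  have "col Xp t = col (A * X + B * U) t" if "t < T" for t
  proof -
    have "col X t = x t" "col U t = u t" "col Xp t = x (Suc t)"
      unfolding Xp_eq using that x u by (auto simp: defs X_minus_def U_minus_def)
    moreover have "col (A * X + B * U) t = A *\<^sub>v col X t + B *\<^sub>v col U t"
      using that A B X U by (subst col_add[of _ n T]) (auto simp: col_mult2[of _ n _ _ T])
    ultimately show ?thesis using step[OF that] by simp
  qed
  hence "Xp = A * X + B * U"
    by (intro mat_col_eqI) (use A B X U Xp in auto)
  have system_vec: "(A' * X + B' * U) *\<^sub>v c = A' *\<^sub>v (X *\<^sub>v c) + B' *\<^sub>v (U *\<^sub>v c)"
    if "A' \<in> carrier_mat n n" "B' \<in> carrier_mat n m" "c \<in> carrier_vec T" for A' B' c
    using that X U assoc_mult_mat_vec[OF that(1) X that(3)] assoc_mult_mat_vec[OF that(2) U that(3)]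
    by (subst add_mult_distrib_mat_vec[of _ n T]) auto
  have Xp_vec: "Xp *\<^sub>v c = A *\<^sub>v (X *\<^sub>v c) + B *\<^sub>v (U *\<^sub>v c)" if "c \<in> carrier_vec T" for c
    using system_vec[OF A B that] \<open>Xp = A * X + B * U\<close> by simp
  \<comment> \<open>Consistency is tested on the pairs \<open>X c\<close>, \<open>U c\<close>, so a
    perturbation preserves it as soon as it cancels on those pairs.\<close>
  have data: "(A', B') \<in> Sigma_data n m T u x \<longleftrightarrow>
      A' \<in> carrier_mat n n \<and> B' \<in> carrier_mat n m \<and>
      (\<forall>c\<in>carrier_vec T. A' *\<^sub>v (X *\<^sub>v c) + B' *\<^sub>v (U *\<^sub>v c) = Xp *\<^sub>v c)" for A' B'
  proof (cases "A' \<in> carrier_mat n n \<and> B' \<in> carrier_mat n m")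
    case True
    hence "A' * X + B' * U \<in> carrier_mat n T" using X U by auto
    hence "Xp = A' * X + B' * U \<longleftrightarrow> (\<forall>c\<in>carrier_vec T. Xp *\<^sub>v c = (A' * X + B' * U) *\<^sub>v c)"
      using mat_eq_by_vec[OF Xp] by metis
    also have "\<dots> \<longleftrightarrow> (\<forall>c\<in>carrier_vec T. A' *\<^sub>v (X *\<^sub>v c) + B' *\<^sub>v (U *\<^sub>v c) = Xp *\<^sub>v c)"
      using True system_vec by auto
    finally show ?thesis using True by (simp add: Sigma_data_def systems_def defs)
  qed (auto simp: Sigma_data_def systems_def)
  have stab: "(A', B') \<in> Sigma_stab n m"
    if "A' \<in> carrier_mat n n" "B' \<in> carrier_mat n m" "K' \<in> carrier_mat m n" "schur (A' + B' * K')" for A' B' K'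
    using that by (auto simp: Sigma_stab_def systems_def stabilizable_def)
  obtain Kt where Kt: "Kt \<in> carrier_mat m n" and stable: "schur (A + B * Kt)"
    using assms(8) by (auto simp: Sigma_stab_def stabilizable_def defs)
  have XUc: "(X @\<^sub>r U) *\<^sub>v c = (X *\<^sub>v c) @\<^sub>v (U *\<^sub>v c)" if "c \<in> carrier_vec T" for c
    by (rule mat_mult_append[OF X U that])
  have XU: "X @\<^sub>r U \<in> carrier_mat (n + m) T" using X U by auto
  have im_X: "v \<in> mat_image X \<longleftrightarrow> (\<exists>c\<in>carrier_vec T. v = X *\<^sub>v c)" for v
    using X by (auto simp: mat_image_def)
  have im_XU: "w \<in> mat_image (X @\<^sub>r U) \<longleftrightarrow> (\<exists>c\<in>carrier_vec T. w = (X *\<^sub>v c) @\<^sub>v (U *\<^sub>v c))" for w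
    using XU XUc by (auto simp: mat_image_def)
  have x_im: "x t \<in> mat_image X" if "t < T" for t
  proof -
    have "x t = X *\<^sub>v unit_vec T t"
      using that X x[of t] by (intro eq_vecI) (auto simp: defs X_minus_def mat_of_cols_index)
    thus ?thesis using im_X by auto
  qed
  \<comment> \<open>The rank deficiency enters here: adding \<open>\<eta>0\<close> alters a
    functional without changing its values on the image of \<open>X\<close>.\<close>
  from rank_deficient_annihilator[OF X] assms(9) obtain \<eta>0 where
    \<eta>0: "\<eta>0 \<in> carrier_vec n" "\<eta>0 \<noteq> 0\<^sub>v n" "\<And>v. v \<in> mat_image X \<Longrightarrow> \<eta>0 \<bullet> v = 0"
    unfolding X_def by blast

  \<comment> \<open>Necessity of (a) and (b)\<close>
  have necessary: "mat_image Xp \<subseteq> mat_image X \<and>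
      mat_image (X @\<^sub>r U) = stacked_product (mat_image X) (carrier_vec m)"
    if inf: "informative_for_stabilization (Sigma_stab n m) n m T u x"
  proof -
    from inf obtain K where K: "K \<in> carrier_mat m n"
      and all: "\<And>A' B'. (A', B') \<in> Sigma_data n m T u x \<Longrightarrow> (A', B') \<in> Sigma_stab n m \<Longrightarrow> schur (A' + B' * K)"
      unfolding informative_for_stabilization_def by blast
    have b: "mat_image (X @\<^sub>r U) = stacked_product (mat_image X) (carrier_vec m)"
    proof (rule ccontr)
      assume "mat_image (X @\<^sub>r U) \<noteq> stacked_product (mat_image X) (carrier_vec m)"
      moreover have "mat_image (X @\<^sub>r U) \<subseteq> stacked_product (mat_image X) (carrier_vec m)"
      proof
        fix w assume "w \<in> mat_image (X @\<^sub>r U)"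
        then obtain c where c: "c \<in> carrier_vec T" "w = (X *\<^sub>v c) @\<^sub>v (U *\<^sub>v c)" using im_XU by blast
        hence "X *\<^sub>v c \<in> mat_image X" "U *\<^sub>v c \<in> carrier_vec m" using im_X U by auto
        thus "w \<in> stacked_product (mat_image X) (carrier_vec m)" unfolding c(2) stacked_product_def by blast
      qed
      ultimately obtain v w where v: "v \<in> mat_image X" and w: "w \<in> carrier_vec m"
        and vw: "v @\<^sub>v w \<notin> mat_image (X @\<^sub>r U)"
        by (auto simp: stacked_product_def)
      have vc: "v \<in> carrier_vec n" using mat_image_carrier[OF X v] .
      have "v @\<^sub>v w \<in> carrier_vec (n + m)" using vc w by auto
      from mat_image_separation[OF XU this vw] obtain \<phi> where \<phi>: "\<phi> \<in> carrier_vec (n + m)"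
        "\<phi> \<bullet> (v @\<^sub>v w) \<noteq> 0" "\<And>z. z \<in> mat_image (X @\<^sub>r U) \<Longrightarrow> \<phi> \<bullet> z = 0" by blast
      define p q where "p = vec_first \<phi> n" and "q = vec_last \<phi> m"
      have p: "p \<in> carrier_vec n" and q: "q \<in> carrier_vec m" by (auto simp: p_def q_def)
      have pq: "\<phi> = p @\<^sub>v q" using \<phi>(1) by (simp add: p_def q_def)
      have ann: "p \<bullet> (X *\<^sub>v c) + q \<bullet> (U *\<^sub>v c) = 0" if "c \<in> carrier_vec T" for c
      proof -
        have "X *\<^sub>v c \<in> carrier_vec n" "U *\<^sub>v c \<in> carrier_vec m" using X U that by auto
        moreover have "\<phi> \<bullet> ((X *\<^sub>v c) @\<^sub>v (U *\<^sub>v c)) = 0" using \<phi>(3) im_XU that by blast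
        ultimately show ?thesis unfolding pq using scalar_prod_append[OF p q] by simp
      qed
      \<comment> \<open>With \<open>q = 0\<close> the functional \<open>p\<close> would annihilate
        the image of \<open>X\<close>, in particular \<open>v\<close>, and \<open>\<phi>\<close>
        would fail to separate.\<close>
      have "q \<noteq> 0\<^sub>v m"
      proof
        assume q0: "q = 0\<^sub>v m"
        obtain c where c: "c \<in> carrier_vec T" "v = X *\<^sub>v c" using v im_X by blast
        have "p \<bullet> v = 0" using ann[OF c(1)] c U by (simp add: q0)
        thus False using \<phi>(2) unfolding pq scalar_prod_append[OF p q vc w] using w by (simp add: q0)
      qed
      define k where "k = K\<^sup>T *\<^sub>v q"
      have k: "k \<in> carrier_vec n" using K q by (auto simp: k_def)
      \<comment> \<open>Under the gain \<open>K\<close> the perturbation changes the closed loop by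
        \<open>outer a (g + k)\<close>, so \<open>g + k\<close> has to be nonzero for the trace to
        move. If \<open>p\<close> fails this, \<open>p + \<eta>0\<close> has the same values on the
        data and succeeds.\<close>
      have "\<exists>g\<in>carrier_vec n. g + k \<noteq> 0\<^sub>v n \<and> (\<forall>v\<in>mat_image X. g \<bullet> v = p \<bullet> v)"
      proof (cases "p + k = 0\<^sub>v n")
        case True
        have "(p + \<eta>0) + k = \<eta>0 + (p + k)" using p k \<eta>0(1) by (intro eq_vecI) auto
        hence "(p + \<eta>0) + k \<noteq> 0\<^sub>v n" using True \<eta>0 by simp
        moreover have "(p + \<eta>0) \<bullet> v = p \<bullet> v" if "v \<in> mat_image X" for v
          using add_scalar_prod_distrib[OF p \<eta>0(1) mat_image_carrier[OF X that]] \<eta>0(3)[OF that] by simp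
        moreover have "p + \<eta>0 \<in> carrier_vec n" using p \<eta>0 by auto
        ultimately show ?thesis by blast
      next
        case False
        thus ?thesis using p by blast
      qed
      then obtain g where g: "g \<in> carrier_vec n" and gk: "g + k \<noteq> 0\<^sub>v n"
        and gX: "\<And>v. v \<in> mat_image X \<Longrightarrow> g \<bullet> v = p \<bullet> v" by blast
      have gkc: "g + k \<in> carrier_vec n" using g k by auto
      obtain a K' where a: "a \<in> carrier_vec n" and K': "K' \<in> carrier_mat m n"
        and st: "schur ((A + outer a g) + (B + outer a q) * K')"
        \<comment> \<open>One more than the trace bound for Schur matrices permits.\<close>
        and large: "(g + k) \<bullet> a \<ge> real n - mat_trace (A + B * K) + 1"
        using rank_one_perturbation_input[OF A B Kt stable g q \<open>q \<noteq> 0\<^sub>v m\<close> gkc gk] by metis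
      have A': "A + outer a g \<in> carrier_mat n n" and B': "B + outer a q \<in> carrier_mat n m"
        using A B a g q by auto
      have "(A + outer a g, B + outer a q) \<in> Sigma_data n m T u x"
        unfolding data
      proof (intro conjI ballI)
        fix c :: "real vec" assume c: "c \<in> carrier_vec T"
        define v w where "v = X *\<^sub>v c" and "w = U *\<^sub>v c"
        have v: "v \<in> carrier_vec n" and w: "w \<in> carrier_vec m" using X U c by (auto simp: v_def w_def)
        \<comment> \<open>On the data the contributions of \<open>outer a g\<close> and
          \<open>outer a q\<close> have opposite coefficients and cancel.\<close>
        have "v \<in> mat_image X" using im_X c v_def by blast
        hence "g \<bullet> v + q \<bullet> w = 0" using ann[OF c] gX by (simp add: v_def w_def)
        hence gq: "g \<bullet> v = - (q \<bullet> w)" by simp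
        have "A *\<^sub>v v \<in> carrier_vec n" "B *\<^sub>v w \<in> carrier_vec n" using A B v w by auto
        moreover have "(A + outer a g) *\<^sub>v v = A *\<^sub>v v + (g \<bullet> v) \<cdot>\<^sub>v a"
          using add_mult_distrib_mat_vec[OF A _ v] a g outer_mult_vec[OF g v] by auto
        moreover have "(B + outer a q) *\<^sub>v w = B *\<^sub>v w + (q \<bullet> w) \<cdot>\<^sub>v a"
          using add_mult_distrib_mat_vec[OF B _ w] a q outer_mult_vec[OF q w] by auto
        ultimately have "(A + outer a g) *\<^sub>v v + (B + outer a q) *\<^sub>v w = A *\<^sub>v v + B *\<^sub>v w"
          using a A B unfolding gq by (intro eq_vecI) (auto simp del: index_mult_mat_vec)
        thus "(A + outer a g) *\<^sub>v (X *\<^sub>v c) + (B + outer a q) *\<^sub>v (U *\<^sub>v c) = Xp *\<^sub>v c"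
          using Xp_vec[OF c] by (simp add: v_def w_def)
      qed (use A' B' in auto)
      from all[OF this stab[OF A' B' K' st]]
      have sch: "schur ((A + outer a g) + (B + outer a q) * K)" .
      have "(B + outer a q) * K = B * K + outer a k"
        unfolding k_def outer_mult[OF q K, symmetric]
        by (rule add_mult_distrib_mat[OF B _ K]) (use a q in auto)
      hence "(A + outer a g) + (B + outer a q) * K = (A + outer a (g + k)) + B * K"
        using A B K a g k by (intro eq_matI) (auto simp: algebra_simps simp del: index_mult_mat(1))
      with sch have "(g + k) \<bullet> a \<le> real n - mat_trace (A + B * K)"
        using schur_rank_one_update_bound[OF A B K a gkc] by simp
      thus False using large by simp
    qed
    \<comment> \<open>Every functional vanishing on the image of \<open>X\<close> vanishes on the
      reachable subspace. Strong induction makes \<open>l\<close> the first index of failure, as the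
      state perturbation requires; that perturbation is invisible to the data since
      \<open>\<eta>\<close> annihilates the image of \<open>X\<close>.\<close>
    have no_escape: "((\<lambda>v. A\<^sup>T *\<^sub>v v) ^^ l) \<eta> \<bullet> (B *\<^sub>v e) = 0"
      if \<eta>: "\<eta> \<in> carrier_vec n" and ann: "\<And>v. v \<in> mat_image X \<Longrightarrow> \<eta> \<bullet> v = 0"
        and e: "e \<in> carrier_vec m" for \<eta> l e
      using e
    proof (induction l arbitrary: e rule: less_induct)
      case (less l)
      show ?case
      proof (rule ccontr)
        assume ne: "((\<lambda>v. A\<^sup>T *\<^sub>v v) ^^ l) \<eta> \<bullet> (B *\<^sub>v e) \<noteq> 0"
        obtain d K' where d: "d \<in> carrier_vec n" and K': "K' \<in> carrier_mat m n"
          and st: "schur ((A + outer d \<eta>) + B * K')"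
          and large: "\<eta> \<bullet> d = real n - mat_trace (A + B * K) + 1"
          using rank_one_perturbation_state[OF A B Kt stable \<eta> less.prems less.IH ne] by metis
        have A': "A + outer d \<eta> \<in> carrier_mat n n" using A d \<eta> by auto
        have "(A + outer d \<eta>, B) \<in> Sigma_data n m T u x"
          unfolding data
        proof (intro conjI ballI)
          fix c :: "real vec" assume c: "c \<in> carrier_vec T"
          have v: "X *\<^sub>v c \<in> carrier_vec n" using X c by auto
          have "\<eta> \<bullet> (X *\<^sub>v c) = 0" using ann im_X c by blast
          moreover have "(A + outer d \<eta>) *\<^sub>v (X *\<^sub>v c) = A *\<^sub>v (X *\<^sub>v c) + (\<eta> \<bullet> (X *\<^sub>v c)) \<cdot>\<^sub>v d"
            using add_mult_distrib_mat_vec[OF A _ v] d \<eta> outer_mult_vec[OF \<eta> v] by auto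
          moreover have "A *\<^sub>v (X *\<^sub>v c) + 0 \<cdot>\<^sub>v d = A *\<^sub>v (X *\<^sub>v c)"
            using A d by (intro eq_vecI) (auto simp del: index_mult_mat_vec)
          ultimately show "(A + outer d \<eta>) *\<^sub>v (X *\<^sub>v c) + B *\<^sub>v (U *\<^sub>v c) = Xp *\<^sub>v c"
            using Xp_vec[OF c] by simp
        qed (use A' B in auto)
        from all[OF this stab[OF A' B K' st]] have "schur ((A + outer d \<eta>) + B * K)" .
        from schur_rank_one_update_bound[OF A B K d \<eta> this] show False using large by simp
      qed
    qed
    have xT: "\<eta> \<bullet> x T = 0"
      if \<eta>: "\<eta> \<in> carrier_vec n" and ann: "\<And>v. v \<in> mat_image X \<Longrightarrow> \<eta> \<bullet> v = 0" for \<eta>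
    proof -
      define \<theta> where "\<theta> = (\<lambda>i. ((\<lambda>v. A\<^sup>T *\<^sub>v v) ^^ i) \<eta>)"
      have \<theta>: "\<theta> i \<in> carrier_vec n" for i using A \<eta> by (induction i) (auto simp: \<theta>_def)
      \<comment> \<open>By \<open>no_escape\<close> the inputs do not contribute, so applying
        \<open>A\<^sup>T\<close> to the functional amounts to shifting time by one.\<close>
      have \<theta>x: "\<theta> k \<bullet> x i = \<eta> \<bullet> x (i + k)" if "i + k \<le> T" for i k
        using that
      proof (induction k arbitrary: i)
        case (Suc k)
        have xi: "x i \<in> carrier_vec n" "u i \<in> carrier_vec m" using x u Suc.prems by auto
        hence c: "A *\<^sub>v x i \<in> carrier_vec n" "B *\<^sub>v u i \<in> carrier_vec n" using A B by auto
        have "\<theta> (Suc k) \<bullet> x i = \<theta> k \<bullet> (A *\<^sub>v x i)"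
          using transpose_vec_mult_scalar[OF A xi(1) \<theta>[of k]] by (simp add: \<theta>_def)
        also have "\<dots> = \<theta> k \<bullet> x (Suc i)"
          using step[of i] Suc.prems no_escape[OF \<eta> ann xi(2), of k] scalar_prod_add_distrib[OF \<theta>[of k] c]
          by (simp add: \<theta>_def)
        also have "\<dots> = \<eta> \<bullet> x (i + Suc k)" using Suc.IH[of "Suc i"] Suc.prems by simp
        finally show ?case .
      qed (simp add: \<theta>_def)
      \<comment> \<open>Condition (b), applied to the zero state and a unit input, yields a relation
        \<open>X c = 0\<close> whose coefficients are not all zero, since \<open>U c\<close> is
        nonzero.\<close>
      have "unit_vec m 0 \<in> carrier_vec m" "0\<^sub>v n \<in> mat_image X"
        using im_X X by (auto intro!: bexI[of _ "0\<^sub>v T"])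
      hence "0\<^sub>v n @\<^sub>v unit_vec m 0 \<in> mat_image (X @\<^sub>r U)"
        unfolding b stacked_product_def by blast
      then obtain c where c: "c \<in> carrier_vec T" and c': "0\<^sub>v n @\<^sub>v unit_vec m 0 = (X *\<^sub>v c) @\<^sub>v (U *\<^sub>v c)"
        using im_XU by blast
      have "0\<^sub>v n = X *\<^sub>v c \<and> unit_vec m 0 = U *\<^sub>v c"
        using append_vec_eq[OF zero_carrier_vec mult_mat_vec_carrier[OF X c]] c' by blast
      hence c0: "X *\<^sub>v c = 0\<^sub>v n" and cU: "U *\<^sub>v c = unit_vec m 0" by auto
      have "\<exists>t<T. c $ t \<noteq> 0"
      proof (rule ccontr)
        assume "\<not> (\<exists>t<T. c $ t \<noteq> 0)"
        hence "c = 0\<^sub>v T" using c by (intro eq_vecI) auto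
        moreover have "U *\<^sub>v 0\<^sub>v T = 0\<^sub>v m" using U by (intro eq_vecI) auto
        ultimately have "unit_vec m 0 = (0\<^sub>v m :: real vec)" using cU by simp
        thus False using assms(2) unit_vec_nonzero[of 0 m] by blast
      qed
      then obtain t0 where t0: "t0 < T" "c $ t0 \<noteq> 0" by blast
      \<comment> \<open>The last sample with a nonzero coefficient. The functional
        \<open>\<theta> (T - j)\<close> shifts it to time \<open>T\<close> and every earlier sample
        to a time before \<open>T\<close>, where \<open>\<eta>\<close> vanishes; only the term with
        \<open>x T\<close> is left.\<close>
      define j where "j = (GREATEST t. t < T \<and> c $ t \<noteq> 0)"
      have "j < T \<and> c $ j \<noteq> 0"
        unfolding j_def by (rule GreatestI_nat[of _ t0 T]) (use t0 in auto)
      hence j: "j < T" "c $ j \<noteq> 0" by auto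
      have j_max: "c $ t = 0" if "t < T" "j < t" for t
      proof (rule ccontr)
        assume "c $ t \<noteq> 0"
        hence "t \<le> j" unfolding j_def by (intro Greatest_le_nat[of _ t T]) (use that in auto)
        thus False using that by simp
      qed
      have "0 = \<theta> (T - j) \<bullet> (X *\<^sub>v c)" using c0 \<theta> by simp
      also have "\<dots> = (\<Sum>t<T. c $ t * (\<theta> (T - j) \<bullet> x t))" by (rule Xc[OF \<theta> c])
      also have "\<dots> = (\<Sum>t<T. if t = j then c $ j * (\<eta> \<bullet> x T) else 0)"
      proof (rule sum.cong[OF refl])
        fix t assume t: "t \<in> {..<T}"
        consider "t = j" | "j < t" | "t < j" by linarith
        thus "c $ t * (\<theta> (T - j) \<bullet> x t) = (if t = j then c $ j * (\<eta> \<bullet> x T) else 0)"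
        proof cases
          case 1
          thus ?thesis using \<theta>x[of j "T - j"] j by simp
        next
          case 2
          thus ?thesis using j_max t by simp
        next
          case 3
          thus ?thesis using \<theta>x[of t "T - j"] ann[OF x_im[of "t + (T - j)"]] j by simp
        qed
      qed
      also have "\<dots> = c $ j * (\<eta> \<bullet> x T)" using j by simp
      finally show ?thesis using j by simp
    qed
    have "x T \<in> mat_image X"
      using mat_image_separation[OF X x[of T]] xT by blast
    hence x_im': "x t \<in> mat_image X" if "t \<le> T" for t
      using that x_im by (cases "t = T") auto
    have "mat_image Xp \<subseteq> mat_image X"
    proof
      fix v assume v: "v \<in> mat_image Xp"
      then obtain c where c: "c \<in> carrier_vec T" "v = Xp *\<^sub>v c" using Xp by (auto simp: mat_image_def)
      show "v \<in> mat_image X"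
      proof (rule ccontr)
        assume "v \<notin> mat_image X"
        from mat_image_separation[OF X mat_image_carrier[OF Xp v] this] obtain \<eta> where
          \<eta>: "\<eta> \<in> carrier_vec n" "\<eta> \<bullet> v \<noteq> 0" "\<And>v. v \<in> mat_image X \<Longrightarrow> \<eta> \<bullet> v = 0" by blast
        have "\<eta> \<bullet> v = 0"
          unfolding c(2) Xpc[OF \<eta>(1) c(1)] using \<eta>(3) x_im' by (intro sum.neutral) auto
        thus False using \<eta>(2) by simp
      qed
    qed
    thus ?thesis using b by blast
  qed

  \<comment> \<open>Sufficiency of (a) and (b)\<close>
  have sufficient: "informative_for_stabilization (Sigma_stab n m) n m T u x"
    if a: "mat_image Xp \<subseteq> mat_image X"
      and b: "mat_image (X @\<^sub>r U) = stacked_product (mat_image X) (carrier_vec m)"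
    unfolding informative_for_stabilization_def
  \<comment> \<open>The common gain is any gain stabilizing the true system.\<close>
  proof (intro bexI[OF _ Kt] ballI, clarify)
    fix A' B' assume dat: "(A', B') \<in> Sigma_data n m T u x" and "(A', B') \<in> Sigma_stab n m"
    then obtain K' where K': "K' \<in> carrier_mat m n" and st: "schur (A' + B' * K')"
      by (auto simp: Sigma_stab_def stabilizable_def)
    have A': "A' \<in> carrier_mat n n" and B': "B' \<in> carrier_mat n m"
      and eq: "\<And>c. c \<in> carrier_vec T \<Longrightarrow> A' *\<^sub>v (X *\<^sub>v c) + B' *\<^sub>v (U *\<^sub>v c) = Xp *\<^sub>v c"
      using dat data by blast+
    \<comment> \<open>By (b) the pair is \<open>X c\<close> and \<open>U c\<close> for some
      \<open>c\<close>, so both systems send it to \<open>Xp c\<close>, which lies in the image of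
      \<open>X\<close> by (a).\<close>
    have joint: "A' *\<^sub>v v + B' *\<^sub>v w = A *\<^sub>v v + B *\<^sub>v w \<and> A' *\<^sub>v v + B' *\<^sub>v w \<in> mat_image X"
      if v: "v \<in> mat_image X" and w: "w \<in> carrier_vec m" for v w
    proof -
      have "v @\<^sub>v w \<in> mat_image (X @\<^sub>r U)" unfolding b stacked_product_def using v w by blast
      then obtain c where c: "c \<in> carrier_vec T" "v @\<^sub>v w = (X *\<^sub>v c) @\<^sub>v (U *\<^sub>v c)"
        using im_XU by blast
      have "v = X *\<^sub>v c \<and> w = U *\<^sub>v c"
        using append_vec_eq[OF mat_image_carrier[OF X v] mult_mat_vec_carrier[OF X c(1)]] c(2) by blast
      moreover have "Xp *\<^sub>v c \<in> mat_image Xp" using c Xp by (auto simp: mat_image_def)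
      ultimately show ?thesis using eq[OF c(1)] Xp_vec[OF c(1)] a by auto
    qed
    have zero: "0\<^sub>v n \<in> mat_image X"
      using im_X X by (auto intro!: bexI[of _ "0\<^sub>v T"])
    have B_im: "B' *\<^sub>v w = B *\<^sub>v w \<and> B' *\<^sub>v w \<in> mat_image X" if w: "w \<in> carrier_vec m" for w
    proof -
      have "B' *\<^sub>v w \<in> carrier_vec n" "B *\<^sub>v w \<in> carrier_vec n" "A' *\<^sub>v 0\<^sub>v n = 0\<^sub>v n" "A *\<^sub>v 0\<^sub>v n = 0\<^sub>v n"
        using A A' B B' w by auto
      thus ?thesis using joint[OF zero w] by auto
    qed
    have A_im: "A' *\<^sub>v v = A *\<^sub>v v \<and> A' *\<^sub>v v \<in> mat_image X" if v: "v \<in> mat_image X" for v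
    proof -
      have "A' *\<^sub>v v \<in> carrier_vec n" "A *\<^sub>v v \<in> carrier_vec n" "B' *\<^sub>v 0\<^sub>v m = 0\<^sub>v n" "B *\<^sub>v 0\<^sub>v m = 0\<^sub>v n"
        using A A' B B' mat_image_carrier[OF X v] by auto
      thus ?thesis using joint[OF v, of "0\<^sub>v m"] by auto
    qed
    have "B' = B" using mat_eq_by_vec[OF B' B] B_im by blast
    from orth_projection[OF X] obtain P where P: "P \<in> carrier_mat n n"
      and im: "\<And>y. y \<in> carrier_vec n \<Longrightarrow> P *\<^sub>v y \<in> mat_image X"
      and fx: "\<And>v. v \<in> mat_image X \<Longrightarrow> P *\<^sub>v v = v" by metis
    \<comment> \<open>\<open>N\<close> is the closed loop to be shown Schur. It agrees with the true
      closed loop \<open>N0\<close> on the image of \<open>X\<close>, and with \<open>N'\<close>,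
      closed by the system's own gain, modulo that image, because \<open>B\<close> maps into
      it.\<close>
    define N N' N0 where "N = A' + B * Kt" and "N' = A' + B * K'" and "N0 = A + B * Kt"
    have c: "N \<in> carrier_mat n n" "N' \<in> carrier_mat n n" "N0 \<in> carrier_mat n n"
      using A A' B Kt K' by (auto simp: N_def N'_def N0_def)
    have cl: "(A1 + B * K1) *\<^sub>v v = A1 *\<^sub>v v + B *\<^sub>v (K1 *\<^sub>v v)"
      if "A1 \<in> carrier_mat n n" "K1 \<in> carrier_mat m n" "v \<in> carrier_vec n" for A1 K1 v
      using that B assoc_mult_mat_vec[OF B that(2,3)]
      by (subst add_mult_distrib_mat_vec[of _ n n]) auto
    have Pv: "P *\<^sub>v v \<in> carrier_vec n" if "v \<in> carrier_vec n" for v using P that by auto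
    have NPv: "N *\<^sub>v (P *\<^sub>v v) = N0 *\<^sub>v (P *\<^sub>v v) \<and> N *\<^sub>v (P *\<^sub>v v) \<in> mat_image X"
      if v: "v \<in> carrier_vec n" for v
    proof -
      have "Kt *\<^sub>v (P *\<^sub>v v) \<in> carrier_vec m" using Kt Pv[OF v] by auto
      thus ?thesis
        unfolding N_def N0_def cl[OF A' Kt Pv[OF v]] cl[OF A Kt Pv[OF v]]
        using joint[OF im[OF v], of "Kt *\<^sub>v (P *\<^sub>v v)"] \<open>B' = B\<close> by auto
    qed
    have PNPv: "P *\<^sub>v (N *\<^sub>v (P *\<^sub>v v)) = N *\<^sub>v (P *\<^sub>v v)" if "v \<in> carrier_vec n" for v
      using NPv[OF that] fx by blast
    have "schur N"
    proof (rule schur_restriction_quotient[OF c P])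
      show "P * P = P"
        by (rule mat_eq_by_vec[of _ n n]) (use P im fx in \<open>auto simp: assoc_mult_mat_vec[OF P P]\<close>)
      show "N * P = N0 * P"
        by (rule mat_eq_by_vec[of _ n n])
          (use P c NPv in \<open>auto simp: assoc_mult_mat_vec[OF c(1) P] assoc_mult_mat_vec[OF c(3) P]\<close>)
      have NP: "N * P \<in> carrier_mat n n" using c P by auto
      show "P * (N * P) = N * P"
        by (rule mat_eq_by_vec[of _ n n])
          (use P PNPv NP in \<open>auto simp: assoc_mult_mat_vec[OF c(1) P] assoc_mult_mat_vec[OF P NP]\<close>)
      have KK: "K' - Kt \<in> carrier_mat m n" using Kt by (rule minus_carrier_mat)
      have "B * (K' - Kt) = B * K' - B * Kt" by (rule mult_minus_distrib_mat[OF B K' Kt])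
      hence D: "N' - N = B * (K' - Kt)"
        unfolding N_def N'_def using A' B K' Kt by (intro eq_matI) (auto simp del: index_mult_mat(1))
      have BK: "B * (K' - Kt) \<in> carrier_mat n n" using B KK by auto
      show "P * (N' - N) = N' - N"
        unfolding D
      proof (rule mat_eq_by_vec[OF mult_carrier_mat[OF P BK] BK])
        fix v :: "real vec" assume v: "v \<in> carrier_vec n"
        have "B *\<^sub>v ((K' - Kt) *\<^sub>v v) \<in> mat_image X"
          using B_im mult_mat_vec_carrier[OF KK v] \<open>B' = B\<close> by blast
        thus "(P * (B * (K' - Kt))) *\<^sub>v v = (B * (K' - Kt)) *\<^sub>v v"
          using fx assoc_mult_mat_vec[OF P BK v] assoc_mult_mat_vec[OF B KK v] by simp
      qed
      show "schur N0" using stable by (simp add: N0_def)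
      show "schur N'" using st \<open>B' = B\<close> by (simp add: N'_def)
    qed
    thus "schur (A' + B' * Kt)" using \<open>B' = B\<close> by (simp add: N_def)
  qed
  show ?thesis
    unfolding defs(3-5)[symmetric] using necessary sufficient by blast
qed

end
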